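(* Let $X$ be an infinite dimensional complex Banach space and let $T\in L(X)$. The following conditions are equivalent: (i) $H_0(T)$ is closed and there exists a closed subspace $M$ of $X$ such that $(M,H_0(T))\in Red(T)$ and $T(M)$ is closed; (ii) there exists $(M,N)\in Red(T)$ such that $T_M$ is bounded below and $T_N$ is quasinilpotent; (iii) $T$ admits a generalized Kato decomposition and $0$ is not an accumulation point of $\sigma_{ap}(T)$; (iv) $T$ admits a generalized Kato decomposition and $0$ is not an interior point of $\sigma_{ap}(T)$; (v) there exists a bounded projection $P$ on $X$ which commutes with $T$ such that $T+P$ is bounded below and $TP$ is quasinilpotent; (vi) there exists $(M,N)\in Red(T)$ such that $T_M$ is upper semi-Browder and $T_N$ is quasinilpotent; (vii) $T$ admits a generalized Kato decomposition and $0$ is not an accumulation point of $\sigma_{\mathcal{B}_+}(T)$; (viii) $T$ admits a generalized Kato decomposition and $0$ is not an interior point of $\sigma_{\mathcal{B}_+}(T)$; (ix) there exists a bounded projection $P$ on $X$ which commutes with $T$ such that $T+P$ is upper semi-Browder and $TP$ is quasinilpotent. In particular, if $T$ satisfies any of the conditions (i)–(ix), then the subspace $N$ in (ii) is uniquely determined and $N=H_0(T)$.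
   Context: $L(Y)$ is the algebra of bounded linear operators on a Banach space $Y$ (finite dimensional or zero spaces allowed for $Y$); $T-\lambda$ means $T-\lambda I$; $N(S)$, $R(S)$ denote kernel and range of $S\in L(Y)$. $S$ is bounded below if there is $c>0$ with $c\|x\|\le\|Sx\|$ for all $x\in Y$. $S$ is upper semi-Fredholm if $R(S)$ is closed and $\dim N(S)<\infty$; the ascent is $\operatorname{asc}(S)=\inf\{n\ge0:N(S^n)=N(S^{n+1})\}$ ($\inf\emptyset=\infty$); $S$ is upper semi-Browder if it is upper semi-Fredholm and $\operatorname{asc}(S)<\infty$. $\sigma_{ap}(T)=\{\lambda\in\mathbb{C}:T-\lambda\text{ is not bounded below}\}$, $\sigma_{\mathcal{B}_+}(T)=\{\lambda\in\mathbb{C}:T-\lambda\text{ is not upper semi-Browder}\}$. $S$ is quasinilpotent if $\|S^n\|^{1/n}\to 0$. The quasinilpotent part of $T$ is $H_0(T)=\{x\in X:\lim_{n\to\infty}\|T^nx\|^{1/n}=0\}$. $(M,N)\in Red(T)$ means that $M,N$ are closed $T$-invariant subspaces of $X$ with $X=M\oplus N$; $T_M\in L(M)$, $T_N\in L(N)$ are the restrictions of $T$. $S\in L(Y)$ is Kato if $R(S)$ is closed and $N(S)\subset R(S^n)$ for all $n\ge 0$. $T$ admits a generalized Kato decomposition if there is $(M,N)\in Red(T)$ such that $T_M$ is Kato and $T_N$ is quasinilpotent. *)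

theory Defs
  imports "HOL-Analysis.Analysis"
begin

class complex_banach = banach +
  fixes scaleC :: "complex \<Rightarrow> 'a \<Rightarrow> 'a" (infixr "*\<^sub>C" 75)
  assumes scaleC_add_right: "a *\<^sub>C (x + y) = a *\<^sub>C x + a *\<^sub>C y"
    and scaleC_add_left: "(a + b) *\<^sub>C x = a *\<^sub>C x + b *\<^sub>C x"
    and scaleC_scaleC: "a *\<^sub>C (b *\<^sub>C x) = (a * b) *\<^sub>C x"
    and scaleC_one: "1 *\<^sub>C x = x"
    and scaleR_scaleC: "r *\<^sub>R x = complex_of_real r *\<^sub>C x"
    and norm_scaleC: "norm (a *\<^sub>C x) = cmod a * norm x"

global_interpretation complex_vector: vector_space "scaleC :: complex \<Rightarrow> 'a \<Rightarrow> 'a::complex_banach"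
  by unfold_locales (rule scaleC_add_right scaleC_add_left scaleC_scaleC scaleC_one)+

definition finite_cdim :: "'a::complex_banach set \<Rightarrow> bool" where
  "finite_cdim V \<longleftrightarrow> (\<exists>B. finite B \<and> B \<subseteq> V \<and> complex_vector.span B = V)"

definition bounded_clinear :: "('a::complex_banach \<Rightarrow> 'a) \<Rightarrow> bool" where
  "bounded_clinear T \<longleftrightarrow> bounded_linear T \<and> (\<forall>c x. T (c *\<^sub>C x) = c *\<^sub>C T x)"

text \<open>
  A restriction \<open>T\<^sub>Y \<in> L(Y)\<close> to a closed invariant subspace is represented by the
  carrier \<open>Y\<close> together with the ambient map \<open>T\<close>; every notion ending in \<open>_on\<close> takes the carrier
  as its first argument and only depends on the values of the map on \<open>Y\<close>. The whole space is
  \<open>Y = UNIV\<close>. As \<open>Y\<close> is closed, a subset of \<open>Y\<close> is closed in \<open>Y\<close> iff it is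
  closed in the whole space.
\<close>

definition ker_on :: "'a::complex_banach set \<Rightarrow> ('a \<Rightarrow> 'a) \<Rightarrow> 'a set" where
  "ker_on Y S = {x \<in> Y. S x = 0}"

definition bounded_below_on :: "'a::complex_banach set \<Rightarrow> ('a \<Rightarrow> 'a) \<Rightarrow> bool" where
  "bounded_below_on Y S \<longleftrightarrow> (\<exists>c>0. \<forall>x\<in>Y. c * norm x \<le> norm (S x))"

definition upper_semi_Fredholm_on :: "'a::complex_banach set \<Rightarrow> ('a \<Rightarrow> 'a) \<Rightarrow> bool" where
  "upper_semi_Fredholm_on Y S \<longleftrightarrow> closed (S ` Y) \<and> finite_cdim (ker_on Y S)"

definition ascent_on :: "'a::complex_banach set \<Rightarrow> ('a \<Rightarrow> 'a) \<Rightarrow> enat" where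
  "ascent_on Y S = (INF n\<in>{n. ker_on Y (S ^^ n) = ker_on Y (S ^^ Suc n)}. enat n)"

definition upper_semi_Browder_on :: "'a::complex_banach set \<Rightarrow> ('a \<Rightarrow> 'a) \<Rightarrow> bool" where
  "upper_semi_Browder_on Y S \<longleftrightarrow> upper_semi_Fredholm_on Y S \<and> ascent_on Y S < \<infinity>"

definition Kato_on :: "'a::complex_banach set \<Rightarrow> ('a \<Rightarrow> 'a) \<Rightarrow> bool" where
  "Kato_on Y S \<longleftrightarrow> closed (S ` Y) \<and> (\<forall>n. ker_on Y S \<subseteq> (S ^^ n) ` Y)"

text \<open>
  The operator norm on \<open>Y\<close>, in the form used by \<^const>\<open>onorm\<close>; since \<open>0 / 0 = 0\<close>, it
  is \<open>0\<close> on the zero space.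
\<close>

definition onorm_on :: "'a::complex_banach set \<Rightarrow> ('a \<Rightarrow> 'a) \<Rightarrow> real" where
  "onorm_on Y S = (SUP x\<in>Y. norm (S x) / norm x)"

definition quasinilpotent_on :: "'a::complex_banach set \<Rightarrow> ('a \<Rightarrow> 'a) \<Rightarrow> bool" where
  "quasinilpotent_on Y S \<longleftrightarrow> (\<lambda>n. root n (onorm_on Y (S ^^ n))) \<longlonglongrightarrow> 0"

definition quasinilpotent_part :: "('a::complex_banach \<Rightarrow> 'a) \<Rightarrow> 'a set" where
  "quasinilpotent_part T = {x. (\<lambda>n. root n (norm ((T ^^ n) x))) \<longlonglongrightarrow> 0}"

definition sigma_ap :: "('a::complex_banach \<Rightarrow> 'a) \<Rightarrow> complex set" where
  "sigma_ap T = {z. \<not> bounded_below_on UNIV (\<lambda>x. T x - z *\<^sub>C x)}"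

definition sigma_Bplus :: "('a::complex_banach \<Rightarrow> 'a) \<Rightarrow> complex set" where
  "sigma_Bplus T = {z. \<not> upper_semi_Browder_on UNIV (\<lambda>x. T x - z *\<^sub>C x)}"

definition Red :: "('a::complex_banach \<Rightarrow> 'a) \<Rightarrow> ('a set \<times> 'a set) set" where
  "Red T = {(M, N).
     closed M \<and> complex_vector.subspace M \<and> T ` M \<subseteq> M \<and>
     closed N \<and> complex_vector.subspace N \<and> T ` N \<subseteq> N \<and>
     M \<inter> N = {0} \<and> {m + n | m n. m \<in> M \<and> n \<in> N} = UNIV}"

definition generalized_Kato_decomposition :: "('a::complex_banach \<Rightarrow> 'a) \<Rightarrow> bool" where
  "generalized_Kato_decomposition T \<longleftrightarrow>
     (\<exists>M N. (M, N) \<in> Red T \<and> Kato_on M T \<and> quasinilpotent_on N T)"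

definition bounded_projection :: "('a::complex_banach \<Rightarrow> 'a) \<Rightarrow> bool" where
  "bounded_projection P \<longleftrightarrow> bounded_clinear P \<and> P \<circ> P = P"

end

theory Submission imports Defs begin

text \<open>
  The proof runs through (ii). A pair in \<open>Red T\<close> is the same as a bounded projection
  \<open>P\<close> commuting with \<open>T\<close>, by the open mapping theorem for
  \<open>M \<times> N \<rightarrow> X\<close>. For (i), pointwise decay of \<open>T\<^sup>n x\<close> on the closed space
  \<open>H\<^sub>0(T)\<close> is made uniform by Banach--Steinhaus; conversely, a vector of \<open>H\<^sub>0(T)\<close>
  has no component in a summand on which \<open>T\<close> is bounded below. In (ii), \<open>T - z\<close> is bounded
  below for all small \<open>z \<noteq> 0\<close>, which gives all the spectral conditions, the weakest being
  (viii). For (viii) implies (ii), a Kato operator \<open>T\<^sub>M\<close> maps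
  \<open>W = \<Inter>n. T\<^sup>n M\<close>, which contains its kernel, onto itself. So \<open>T - z\<close> is onto
  \<open>W\<close> for small \<open>z\<close>, hence injective on \<open>W\<close> once its ascent is finite, and the map
  \<open>x \<mapsto> x + z u\<close> with \<open>(T - z) u = x\<close> embeds the kernel of \<open>T\<^sub>M\<close> into the
  kernel of \<open>T - z\<close> on \<open>W\<close>. For (vi) implies (ii), Jordan blocks of maximal length are
  split off the upper semi-Browder part one at a time and moved to the quasinilpotent part.
\<close>

section \<open>Open mapping and uniform boundedness on closed subspaces\<close>

text \<open>In the Kato case finite ascent is what excludes a kernel: an operator mapping
  \<open>W\<close> onto itself with a nonzero kernel has strictly growing kernels of powers.
  Non-interiority supplies one suitable \<open>z\<close> in every disc about 0. In the splitting,
  the obstacle is a complement that is both closed and invariant. The span of a Jordan chain ending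
  in a kernel vector \<open>e\<close> has one as soon as some continuous functional is 1 at
  \<open>e\<close> and vanishes on the range of the next power of \<open>T\<close>. This is why the
  length of the chain is the ascent (only then is \<open>e\<close> known to lie outside that range),
  why the powers of \<open>T\<close> must have closed range, and why the Hahn-Banach theorem enters.
  Moving one chain strictly shrinks the finite dimensional kernel, and since the block is nilpotent
  it alters only finitely many powers of \<open>T \<circ> P\<close>. Restrictions are ambient maps
  on a carrier, so the category arguments are carried out relative to a closed subspace, for maps
  defined on the whole space.\<close>

lemma Baire_closed_cover:
  fixes S :: "'a::complete_space set" and A :: "nat \<Rightarrow> 'a set"
  assumes "closed S" "S \<noteq> {}" "S \<subseteq> (\<Union>n. A n)" "\<And>n. closed (A n)"
  obtains n x r where "x \<in> S" "r > 0" "S \<inter> ball x r \<subseteq> A n"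
proof -
  have cm: "completely_metrizable_space (top_of_set S)"
    using assms(1) by (simp add: completely_metrizable_space_closedin completely_metrizable_space_euclidean)
  let ?G = "range (\<lambda>n. S \<inter> A n)"
  have U: "\<Union>?G = S" using assms(3) by auto
  have "\<exists>n. top_of_set S interior_of (S \<inter> A n) \<noteq> {}"
  proof (rule ccontr)
    assume "\<not> ?thesis"
    then have "top_of_set S interior_of \<Union>?G = {}"
      using cm assms(4)
      by (intro Baire_category_alt) (auto intro!: closedin_closed_Int)
    with U \<open>S \<noteq> {}\<close> show False
      by (metis interior_of_topspace topspace_euclidean_subtopology)
  qed
  then obtain n x where "x \<in> top_of_set S interior_of (S \<inter> A n)" by auto
  then obtain V where V: "open V" "x \<in> S \<inter> V" "S \<inter> V \<subseteq> S \<inter> A n"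
    unfolding interior_of_def by (auto simp: openin_open)
  then obtain r where "r > 0" "ball x r \<subseteq> V"
    using open_contains_ball by (metis IntD2)
  with V that[of x r n] show ?thesis by blast
qed

text \<open>Pointwise bounds are given on \<open>S\<close>, so Baire is applied inside
  \<open>S\<close>: some \<open>A k\<close> contains a relative ball, and differences of points of
  that ball control \<open>F n\<close> in every direction of \<open>S\<close>.\<close>

lemma Banach_Steinhaus_on:
  fixes F :: "nat \<Rightarrow> 'a::banach \<Rightarrow> 'b::real_normed_vector"
  assumes S: "closed S" "subspace S" and F: "\<And>n. bounded_linear (F n)"
    and bd: "\<And>x. x \<in> S \<Longrightarrow> \<exists>C. \<forall>n. norm (F n x) \<le> C"
  obtains C where "C > 0" "\<And>n x. x \<in> S \<Longrightarrow> norm (F n x) \<le> C * norm x"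
proof -
  define A where "A k = (\<Inter>n. {x. norm (F n x) \<le> real k})" for k
  have "closed (A k)" for k
    unfolding A_def
    by (intro closed_INT ballI closed_Collect_le continuous_intros)
       (use F linear_continuous_on in blast)
  moreover have "S \<subseteq> (\<Union>k. A k)"
  proof
    fix x assume "x \<in> S"
    with bd obtain C where C: "\<And>n. norm (F n x) \<le> C" by blast
    obtain k where "C \<le> real k" using real_arch_simple by blast
    with C have "x \<in> A k" by (auto simp: A_def intro: order_trans)
    then show "x \<in> (\<Union>k. A k)" by blast
  qed
  moreover have "S \<noteq> {}" using S(2) subspace_0 by blast
  ultimately obtain k x0 r where x0: "x0 \<in> S" "r > 0" "S \<inter> ball x0 r \<subseteq> A k"
    using Baire_closed_cover S(1) by metis
  show ?thesis
  proof (rule that)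
    \<comment> \<open>A vector of length \<open>r / 2\<close> is a difference of two points of the
      ball, so its image has norm at most \<open>2 * k\<close>. Rescaling gives the factor
      \<open>4 / r\<close>; adding 1 keeps the constant positive when \<open>k = 0\<close>.\<close>
    show "4 * (real k + 1) / r > 0" using x0 by simp
    fix n x assume x: "x \<in> S"
    interpret bounded_linear "F n" by (rule F)
    show "norm (F n x) \<le> 4 * (real k + 1) / r * norm x"
    proof (cases "x = 0")
      case True then show ?thesis by (simp add: zero)
    next
      case False
      define y where "y = (r / (2 * norm x)) *\<^sub>R x"
      have "norm y = r / 2" using False x0 by (simp add: y_def)
      then have "x0 + y \<in> S \<inter> ball x0 r"
        using x0 x S by (simp add: y_def subspace_add subspace_scale dist_norm)
      with x0 have "norm (F n (x0 + y)) \<le> k" by (auto simp: A_def)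
      moreover have "norm (F n x0) \<le> k" using x0 by (auto simp: A_def)
      moreover have "F n y = F n (x0 + y) - F n x0" by (simp add: add)
      ultimately have "norm (F n y) \<le> 2 * real k"
        using norm_triangle_ineq4[of "F n (x0+y)" "F n x0"] by simp
      then have "r / (2 * norm x) * norm (F n x) \<le> 2 * (real k + 1)"
        using x0 by (simp add: y_def scaleR)
      then show ?thesis using False x0 by (simp add: field_simps)
    qed
  qed
qed

text \<open>Closedness of the image makes Baire applicable to it. This yields approximate preimages
  in \<open>S\<close> with controlled norm, and summing the corrections makes them exact,
  completeness of \<open>S\<close> providing the limit.\<close>

lemma open_mapping_on:
  fixes f :: "'a::banach \<Rightarrow> 'b::banach"
  assumes f: "bounded_linear f" and S: "closed S" "subspace S" and cl: "closed (f ` S)"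
  obtains C where "C > 0" "\<And>y. y \<in> f ` S \<Longrightarrow> \<exists>x\<in>S. f x = y \<and> norm x \<le> C * norm y"
proof -
  interpret bounded_linear f by (rule f)
  have sub: "subspace (f ` S)" using S(2) linear_axioms linear_subspace_image by blast
  define A where "A k = closure (f ` (S \<inter> cball 0 (real k)))" for k
  have cover: "f ` S \<subseteq> (\<Union>k. A k)"
  proof
    fix y assume "y \<in> f ` S"
    then obtain x where x: "x \<in> S" "y = f x" by auto
    obtain k where "norm x \<le> real k" using real_arch_simple by blast
    with x have "y \<in> f ` (S \<inter> cball 0 (real k))" by auto
    then have "y \<in> A k" unfolding A_def by (rule rev_subsetD[OF _ closure_subset])
    then show "y \<in> (\<Union>k. A k)" by (rule UN_I[OF UNIV_I])
  qed
  have "f ` S \<noteq> {}" using S(2) subspace_0 by blast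
  moreover have "closed (A k)" for k by (simp add: A_def)
  ultimately obtain k y0 r where y0: "y0 \<in> f ` S" "r > 0" "f ` S \<inter> ball y0 r \<subseteq> A k"
    using Baire_closed_cover[OF cl _ cover] by metis
  define C where "C = 4 * (real k + 1) / r"
  have C: "C > 0" using y0 by (simp add: C_def)
  \<comment> \<open>\<open>y\<close> is scaled to length \<open>r / 2\<close> and added to the
    centre \<open>y0\<close>. Approximating the centre and the translate within \<open>r / 8\<close>
    each leaves an error of \<open>r / 4\<close>, half of the scaled length.\<close>
  have half: "\<exists>x\<in>S. norm x \<le> C * norm y \<and> norm (y - f x) \<le> norm y / 2" if y: "y \<in> f ` S" for y
  proof (cases "y = 0")
    case True then show ?thesis using S subspace_0 by (intro bexI[of _ 0]) (auto simp: zero)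
  next
    case False
    define a where "a = r / (2 * norm y)"
    have a: "a > 0" using False y0 by (simp add: a_def)
    have "norm (a *\<^sub>R y) = r / 2" using False y0 by (simp add: a_def)
    then have "y0 + a *\<^sub>R y \<in> f ` S \<inter> ball y0 r"
      using y0 y sub by (simp add: subspace_add subspace_scale dist_norm)
    with y0 have 1: "y0 + a *\<^sub>R y \<in> A k" by blast
    have 2: "y0 \<in> A k" using y0 by auto
    have e: "r / 8 > 0" using y0 by simp
    obtain u where u: "u \<in> S" "norm u \<le> k" "dist (f u) (y0 + a *\<^sub>R y) < r / 8"
      using 1 e unfolding A_def closure_approachable by fastforce
    obtain v where v: "v \<in> S" "norm v \<le> k" "dist (f v) y0 < r / 8"
      using 2 e unfolding A_def closure_approachable by fastforce
    define x where "x = (1 / a) *\<^sub>R (u - v)"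
    have "norm (u - v) \<le> 2 * (real k + 1)" using norm_triangle_ineq4[of u v] u v by simp
    then have "norm (u - v) / a \<le> 2 * (real k + 1) / a"
      using a by (intro divide_right_mono) auto
    also have "\<dots> = C * norm y" using False y0 by (simp add: C_def a_def)
    finally have "norm x \<le> C * norm y" using a by (simp add: x_def)
    moreover have "a *\<^sub>R (y - f x) = (y0 + a *\<^sub>R y - f u) - (y0 - f v)"
      using a by (simp add: x_def scaleR diff algebra_simps)
    then have "a * norm (y - f x) \<le> r / 4"
    proof -
      assume eq: "a *\<^sub>R (y - f x) = (y0 + a *\<^sub>R y - f u) - (y0 - f v)"
      have "a * norm (y - f x) = norm (a *\<^sub>R (y - f x))" using a by simp
      also have "\<dots> \<le> norm (y0 + a *\<^sub>R y - f u) + norm (y0 - f v)"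
        unfolding eq by (rule norm_triangle_ineq4)
      also have "\<dots> \<le> r / 4"
        using u(3) v(3) by (simp add: dist_norm norm_minus_commute)
      finally show ?thesis .
    qed
    then have "norm (y - f x) \<le> norm y / 2"
      using False y0 by (simp add: a_def field_simps)
    moreover have "x \<in> S" using u v S by (simp add: x_def subspace_diff subspace_scale)
    ultimately show ?thesis by blast
  qed
  then obtain g where g: "\<And>y. y \<in> f ` S \<Longrightarrow> g y \<in> S \<and> norm (g y) \<le> C * norm y \<and> norm (y - f (g y)) \<le> norm y / 2"
    by metis
  show ?thesis
  proof (rule that)
    show "2 * C > 0" using C by simp
    fix y assume y: "y \<in> f ` S"
    \<comment> \<open>\<open>z n\<close> is the error left after \<open>n\<close> corrections. It
      halves each time, so the corrections \<open>g (z n)\<close> are dominated by a geometric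
      series of sum \<open>2 * C * norm y\<close>.\<close>
    define z where "z n = ((\<lambda>y. y - f (g y)) ^^ n) y" for n
    have z: "z n \<in> f ` S \<and> norm (z n) \<le> norm y * (1/2) ^ n" for n
    proof (induction n)
      case 0 then show ?case using y by (simp add: z_def)
    next
      case (Suc n)
      have zS: "z (Suc n) = z n - f (g (z n))" by (simp add: z_def)
      have "z (Suc n) \<in> f ` S" unfolding zS using Suc g[of "z n"] sub by (simp add: subspace_diff)
      moreover have "norm (z (Suc n)) \<le> norm (z n) / 2" unfolding zS using Suc g[of "z n"] by simp
      moreover have "norm (z n) / 2 \<le> norm y * (1/2) ^ Suc n" using Suc by simp
      ultimately show ?case by (meson order_trans)
    qed
    have gz: "g (z n) \<in> S" "norm (g (z n)) \<le> (C * norm y) * (1/2) ^ n" for n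
    proof -
      show "g (z n) \<in> S" using z g by blast
      have "norm (g (z n)) \<le> C * norm (z n)" using z g by blast
      also have "\<dots> \<le> C * (norm y * (1/2) ^ n)" using z C by (intro mult_left_mono) auto
      finally show "norm (g (z n)) \<le> (C * norm y) * (1/2) ^ n" by (simp add: mult.assoc)
    qed
    have sumn: "summable (\<lambda>n. (C * norm y) * (1/2) ^ n)" by (intro summable_mult summable_geometric) simp
    have sm: "summable (\<lambda>n. norm (g (z n)))"
      by (rule summable_comparison_test'[OF sumn]) (use gz in auto)
    then have sm': "summable (\<lambda>n. g (z n))" by (rule summable_norm_cancel)
    define x where "x = (\<Sum>n. g (z n))"
    have "norm x \<le> (\<Sum>n. (C * norm y) * (1/2) ^ n)"
      unfolding x_def by (rule order_trans[OF summable_norm[OF sm] suminf_le[OF gz(2) sm sumn]])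
    also have "\<dots> = 2 * C * norm y"
      by (subst suminf_mult) (auto simp: suminf_geometric summable_geometric)
    finally have nx: "norm x \<le> 2 * C * norm y" .
    have lim: "(\<lambda>n. \<Sum>i<n. g (z i)) \<longlonglongrightarrow> x"
      unfolding x_def using sm' by (rule summable_LIMSEQ)
    have "x \<in> S"
      by (rule closed_sequentially[OF S(1) _ lim]) (use gz S in \<open>auto intro: subspace_sum\<close>)
    have part: "f (\<Sum>i<n. g (z i)) = y - z n" for n
    proof (induction n)
      case 0 then show ?case by (simp add: z_def zero)
    next
      case (Suc n)
      have "z (Suc n) = z n - f (g (z n))" by (simp add: z_def)
      with Suc show ?case by (simp add: add)
    qed
    have "(\<lambda>n. norm y * (1/2) ^ n) \<longlonglongrightarrow> norm y * 0"
      by (intro tendsto_intros LIMSEQ_power_zero) simp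
    then have bnd: "(\<lambda>n. norm y * (1/2) ^ n) \<longlonglongrightarrow> 0" by simp
    have "z \<longlonglongrightarrow> 0"
      by (rule Lim_null_comparison[OF _ bnd]) (intro always_eventually allI conjunct2[OF z])
    then have "(\<lambda>n. y - z n) \<longlonglongrightarrow> y - 0" by (rule tendsto_diff[OF tendsto_const])
    then have "(\<lambda>n. f (\<Sum>i<n. g (z i))) \<longlonglongrightarrow> y" unfolding part by simp
    with tendsto[OF lim] have "f x = y" by (rule LIMSEQ_unique)
    with nx \<open>x \<in> S\<close> show "\<exists>x\<in>S. f x = y \<and> norm x \<le> 2 * C * norm y" by blast
  qed
qed

section \<open>Reducing pairs and commuting projections\<close>

lemma complex_subspace_imp_subspace:
  "complex_vector.subspace V \<Longrightarrow> subspace V"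
  by (simp add: complex_vector.subspace_def subspace_def scaleR_scaleC)

lemma bounded_clinear_imp_bounded_linear:
  "bounded_clinear T \<Longrightarrow> bounded_linear T"
  by (simp add: bounded_clinear_def)

lemma bounded_clinear_scaleC:
  "bounded_clinear T \<Longrightarrow> T (c *\<^sub>C x) = c *\<^sub>C T x"
  by (simp add: bounded_clinear_def)

lemmas bounded_clinear_add = linear_add[OF bounded_linear.linear[OF bounded_clinear_imp_bounded_linear]]
lemmas bounded_clinear_diff = linear_diff[OF bounded_linear.linear[OF bounded_clinear_imp_bounded_linear]]
lemmas bounded_clinear_0 = linear_0[OF bounded_linear.linear[OF bounded_clinear_imp_bounded_linear]]
lemmas bounded_clinear_sum = linear_sum[OF bounded_linear.linear[OF bounded_clinear_imp_bounded_linear]]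

lemma bounded_linear_scaleC: "bounded_linear ((*\<^sub>C) c :: 'a::complex_banach \<Rightarrow> 'a)"
  by (rule bounded_linear_intro[where K="cmod c"])
     (simp_all add: scaleC_add_right scaleR_scaleC scaleC_scaleC norm_scaleC mult.commute)

lemma bounded_clinear_ident: "bounded_clinear (\<lambda>x. x)"
  by (simp add: bounded_clinear_def)

lemma bounded_clinear_comp:
  "bounded_clinear S \<Longrightarrow> bounded_clinear T \<Longrightarrow> bounded_clinear (\<lambda>x. S (T x))"
  by (auto simp: bounded_clinear_def intro: bounded_linear_compose)

lemma bounded_clinear_plus:
  "bounded_clinear S \<Longrightarrow> bounded_clinear T \<Longrightarrow> bounded_clinear (\<lambda>x. S x + T x)"
  by (auto simp: bounded_clinear_def scaleC_add_right intro: bounded_linear_add)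

lemma bounded_clinear_minus:
  "bounded_clinear S \<Longrightarrow> bounded_clinear T \<Longrightarrow> bounded_clinear (\<lambda>x. S x - T x)"
  by (auto simp: bounded_clinear_def complex_vector.scale_right_diff_distrib intro: bounded_linear_sub)

lemma bounded_clinear_scale: "bounded_clinear ((*\<^sub>C) c)"
  by (simp add: bounded_clinear_def bounded_linear_scaleC scaleC_scaleC mult.commute)

lemma bounded_clinear_funpow:
  "bounded_clinear T \<Longrightarrow> bounded_clinear (T ^^ n)"
proof (induction n)
  case 0 then show ?case by (simp add: bounded_clinear_ident id_def)
next
  case (Suc n) then show ?case using bounded_clinear_comp[of T "T ^^ n"] by (simp add: comp_def)
qed

lemma subspace_image_bounded_clinear:
  assumes "bounded_clinear T" "complex_vector.subspace V"
  shows "complex_vector.subspace (T ` V)"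
  unfolding complex_vector.subspace_def
proof (intro conjI ballI allI)
  show "0 \<in> T ` V"
    using assms by (metis bounded_clinear_0 complex_vector.subspace_0 image_eqI)
  fix x y c assume x: "x \<in> T ` V"
  show "c *\<^sub>C x \<in> T ` V"
    using x assms by (force simp: bounded_clinear_scaleC[symmetric] intro: complex_vector.subspace_scale)
  assume "y \<in> T ` V"
  with x show "x + y \<in> T ` V"
    using assms by (force simp: bounded_clinear_add[symmetric] intro: complex_vector.subspace_add)
qed

lemma subspace_ker_on:
  assumes "bounded_clinear T" "complex_vector.subspace V"
  shows "complex_vector.subspace (ker_on V T)"
  using assms
  by (auto simp: complex_vector.subspace_def ker_on_def bounded_clinear_0 bounded_clinear_add
      bounded_clinear_scaleC complex_vector.scale_zero_right)

lemma funpow_in_invariant: "x \<in> M \<Longrightarrow> T ` M \<subseteq> M \<Longrightarrow> (T ^^ n) x \<in> M"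
  by (induction n) auto

lemma funpow_commute_eq: "T \<circ> P = P \<circ> T \<Longrightarrow> (T ^^ n) (P x) = P ((T ^^ n) x)"
  by (induction n) (simp_all add: fun_eq_iff)

section \<open>Operators bounded below\<close>

lemma bounded_below_on_imp_closed_image:
  assumes "bounded_linear T" "closed Y" "subspace Y" "bounded_below_on Y T"
  shows "closed (T ` Y)"
proof -
  obtain c where "c > 0" "\<forall>x\<in>Y. c * norm x \<le> norm (T x)"
    using assms(4) unfolding bounded_below_on_def by blast
  then have "complete (T ` Y)"
    using assms(2) by (intro complete_isometric_image[OF _ assms(3,1)]) (simp_all add: complete_eq_closed)
  then show ?thesis by (simp add: complete_eq_closed)
qed

text \<open>For the converse, the open mapping theorem gives some preimage of \<open>T x\<close>
  with controlled norm, and the trivial kernel forces that preimage to be \<open>x\<close>.\<close>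

lemma bounded_below_on_iff:
  assumes T: "bounded_linear T" and Y: "closed Y" "subspace Y"
  shows "bounded_below_on Y T \<longleftrightarrow> closed (T ` Y) \<and> ker_on Y T = {0}"
proof safe
  interpret bounded_linear T by (rule T)
  assume bb: "bounded_below_on Y T"
  show "closed (T ` Y)" using assms bb by (rule bounded_below_on_imp_closed_image)
  obtain c where c: "c > 0" "\<And>x. x \<in> Y \<Longrightarrow> c * norm x \<le> norm (T x)"
    using bb by (auto simp: bounded_below_on_def)
  {
    fix x assume "x \<in> ker_on Y T"
    with c(2)[of x] c(1) show "x = 0"
      by (simp add: ker_on_def mult_le_0_iff)
  }
  show "0 \<in> ker_on Y T" using Y by (simp add: ker_on_def subspace_0 zero)
next
  interpret bounded_linear T by (rule T)
  assume cl: "closed (T ` Y)" and k: "ker_on Y T = {0}"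
  obtain C where C: "C > 0" "\<And>y. y \<in> T ` Y \<Longrightarrow> \<exists>x\<in>Y. T x = y \<and> norm x \<le> C * norm y"
    using open_mapping_on[OF T Y cl] by blast
  show "bounded_below_on Y T"
    unfolding bounded_below_on_def
  proof (intro exI[of _ "1 / C"] conjI ballI)
    show "1 / C > 0" using C by simp
    fix x assume x: "x \<in> Y"
    then obtain z where z: "z \<in> Y" "T z = T x" "norm z \<le> C * norm (T x)" using C by blast
    then have "z - x \<in> ker_on Y T" using x Y by (simp add: ker_on_def subspace_diff diff)
    with k have "z = x" by simp
    with z C show "1 / C * norm x \<le> norm (T x)" by (simp add: field_simps)
  qed
qed

section \<open>Quasinilpotence as decay faster than every geometric sequence\<close>

lemma root_tendsto_0_iff:
  fixes a :: "nat \<Rightarrow> real"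
  assumes a: "\<And>n. a n \<ge> 0"
  shows "(\<lambda>n. root n (a n)) \<longlonglongrightarrow> 0 \<longleftrightarrow> (\<forall>e>0. \<forall>\<^sub>F n in sequentially. a n \<le> e ^ n)"
proof
  assume L: "(\<lambda>n. root n (a n)) \<longlonglongrightarrow> 0"
  show "\<forall>e>0. \<forall>\<^sub>F n in sequentially. a n \<le> e ^ n"
  proof (intro allI impI)
    fix e :: real assume "e > 0"
    then have "\<forall>\<^sub>F n in sequentially. root n (a n) < e"
      using order_tendstoD(2)[OF L] by blast
    \<comment> \<open>Index 0 is excluded because \<open>root 0\<close> is constantly 0 and does not
      invert the power.\<close>
    with eventually_gt_at_top[of 0] show "\<forall>\<^sub>F n in sequentially. a n \<le> e ^ n"
    proof eventually_elim
      case (elim n)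
      have "a n = root n (a n) ^ n" using elim a by simp
      also have "\<dots> \<le> e ^ n" using elim a by (intro power_mono) auto
      finally show ?case .
    qed
  qed
next
  assume R: "\<forall>e>0. \<forall>\<^sub>F n in sequentially. a n \<le> e ^ n"
  show "(\<lambda>n. root n (a n)) \<longlonglongrightarrow> 0"
  proof (rule tendstoI)
    fix e :: real assume e: "e > 0"
    then have "\<forall>\<^sub>F n in sequentially. a n \<le> (e / 2) ^ n" using R by simp
    with eventually_gt_at_top[of 0] show "\<forall>\<^sub>F n in sequentially. dist (root n (a n)) 0 < e"
    proof eventually_elim
      case (elim n)
      have "root n (a n) \<le> root n ((e / 2) ^ n)" using elim by simp
      also have "\<dots> = e / 2" using elim e by (simp add: real_root_power_cancel)
      finally show ?case using e a elim by simp
    qed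
  qed
qed

lemma
  assumes S: "bounded_linear S" and Y: "0 \<in> Y"
  shows le_onorm_on: "x \<in> Y \<Longrightarrow> norm (S x) \<le> onorm_on Y S * norm x"
    and onorm_on_nonneg: "0 \<le> onorm_on Y S"
    and onorm_on_le: "(\<And>x. x \<in> Y \<Longrightarrow> norm (S x) \<le> c * norm x) \<Longrightarrow> 0 \<le> c \<Longrightarrow> onorm_on Y S \<le> c"
proof -
  interpret bounded_linear S by (rule S)
  obtain K where K: "K \<ge> 0" "\<And>x. norm (S x) \<le> norm x * K" using nonneg_bounded by blast
  have bdd: "bdd_above ((\<lambda>x. norm (S x) / norm x) ` Y)"
    by (rule bdd_aboveI2[of _ _ K]) (use K in \<open>auto simp: divide_simps mult.commute\<close>)
  show "norm (S x) \<le> onorm_on Y S * norm x" if "x \<in> Y"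
  proof (cases "x = 0")
    case False
    have "norm (S x) / norm x \<le> onorm_on Y S"
      unfolding onorm_on_def by (rule cSUP_upper[OF that bdd])
    with False show ?thesis by (simp add: divide_simps)
  qed (simp add: zero)
  have "norm (S 0) / norm (0::'a) \<le> onorm_on Y S"
    unfolding onorm_on_def by (rule cSUP_upper[OF Y bdd])
  then show "0 \<le> onorm_on Y S" by simp
  assume "\<And>x. x \<in> Y \<Longrightarrow> norm (S x) \<le> c * norm x" "0 \<le> c"
  then show "onorm_on Y S \<le> c"
    unfolding onorm_on_def using Y
    by (intro cSUP_least) (auto simp: divide_simps)
qed

text \<open>Up to the factor \<open>norm x\<close>, this differs from
  \<open>quasinilpotent_part_iff\<close> by uniformity in \<open>x\<close>; that gap is what
  Banach-Steinhaus closes for condition (i).\<close>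

lemma quasinilpotent_on_iff:
  assumes S: "bounded_clinear S" and Y: "0 \<in> Y"
  shows "quasinilpotent_on Y S \<longleftrightarrow>
    (\<forall>e>0. \<forall>\<^sub>F n in sequentially. \<forall>x\<in>Y. norm ((S ^^ n) x) \<le> e ^ n * norm x)"
proof -
  have bl: "bounded_linear (S ^^ n)" for n
    using S bounded_clinear_funpow bounded_clinear_imp_bounded_linear by blast
  have "onorm_on Y (S ^^ n) \<le> e ^ n \<longleftrightarrow> (\<forall>x\<in>Y. norm ((S ^^ n) x) \<le> e ^ n * norm x)"
    if "e > 0" for e n
    using le_onorm_on[OF bl Y, of _ n] onorm_on_le[OF bl Y, of n "e ^ n"] that
    by (meson less_imp_le mult_right_mono norm_ge_zero order_trans zero_le_power)
  then show ?thesis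
    unfolding quasinilpotent_on_def
    by (subst root_tendsto_0_iff) (auto simp: onorm_on_nonneg[OF bl Y])
qed

lemma quasinilpotent_part_iff:
  "x \<in> quasinilpotent_part T \<longleftrightarrow> (\<forall>e>0. \<forall>\<^sub>F n in sequentially. norm ((T ^^ n) x) \<le> e ^ n)"
  unfolding quasinilpotent_part_def by (simp add: root_tendsto_0_iff)

text \<open>Absorbs a constant, such as the norm of a projection, by doubling the rate of decay;
  since all rates are available, nothing is lost.\<close>

lemma eventually_le_power:
  fixes K e :: real assumes "0 < e"
  shows "\<forall>\<^sub>F n in sequentially. K * (e / 2) ^ n \<le> e ^ n"
proof -
  have "\<forall>\<^sub>F n in sequentially. K \<le> 2 ^ n"
    by (rule eventually_mono[OF eventually_ge_at_top[of "nat \<lceil>K\<rceil>"]])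
       (meson less_imp_le of_nat_less_two_power order_trans nat_ceiling_le_eq)
  then show ?thesis
    by (rule eventually_mono) (use assms in \<open>simp add: power_divide field_simps\<close>)
qed

section \<open>Commuting projections and reducing pairs\<close>

lemma bounded_projectionD:
  assumes "bounded_projection P"
  shows "bounded_clinear P" "P (P x) = P x"
  using assms by (auto simp: bounded_projection_def fun_eq_iff)

lemma range_projection_iff:
  assumes "bounded_projection P" shows "x \<in> range P \<longleftrightarrow> P x = x"
  using bounded_projectionD(2)[OF assms] by (auto intro: range_eqI[OF sym])

text \<open>The decomposition is \<open>x = (x - P x) + P x\<close>. The kernel comes first in the
  pair, so the range of \<open>P\<close> is the summand that will carry the quasinilpotent
  part.\<close>

lemma projection_Red:
  assumes T: "bounded_clinear T" and P: "bounded_projection P" and TP: "T \<circ> P = P \<circ> T"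
  shows "({x. P x = 0}, range P) \<in> Red T"
proof -
  note P1 = bounded_projectionD[OF P] note P2 = P1(1)
  have TP': "T (P x) = P (T x)" for x using TP by (simp add: fun_eq_iff)
  have r: "range P = {x. P x = x}" using range_projection_iff[OF P] by auto
  have cont: "continuous_on UNIV P"
    using P2 bounded_clinear_imp_bounded_linear linear_continuous_on by blast
  have "closed {x. P x = 0}" "closed {x. P x = x}"
    by (auto intro!: closed_Collect_eq continuous_intros cont)
  moreover have "complex_vector.subspace {x. P x = 0}" "complex_vector.subspace {x. P x = x}"
    using P2 by (auto simp: complex_vector.subspace_def bounded_clinear_0 bounded_clinear_add
      bounded_clinear_scaleC complex_vector.scale_zero_right)
  moreover have "x \<in> {m + n |m n. m \<in> {x. P x = 0} \<and> n \<in> {x. P x = x}}" for x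
    by (simp, rule exI[of _ "x - P x"], rule exI[of _ "P x"]) (simp add: bounded_clinear_diff[OF P2] P1)
  ultimately show ?thesis
    unfolding Red_def r
    by (auto simp: bounded_clinear_0[OF T] bounded_clinear_0[OF P2] TP'[symmetric])
qed

lemma Red_projection:
  assumes T: "bounded_clinear T" and MN: "(M, N) \<in> Red T"
  obtains P where "bounded_projection P" "T \<circ> P = P \<circ> T" "M = {x. P x = 0}" "N = range P"
proof -
  from MN have M: "closed M" "complex_vector.subspace M" "T ` M \<subseteq> M"
    and N: "closed N" "complex_vector.subspace N" "T ` N \<subseteq> N"
    and 0: "M \<inter> N = {0}" and all: "{m + n | m n. m \<in> M \<and> n \<in> N} = UNIV"
    unfolding Red_def by auto
  have sum: "\<exists>m\<in>M. \<exists>n\<in>N. x = m + n" for x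
    using UNIV_I[of x] unfolding all[symmetric] by blast
  have uniq: "m = m' \<and> n = n'" if "m + n = m' + n'" "m \<in> M" "m' \<in> M" "n \<in> N" "n' \<in> N" for m m' n n'
  proof -
    have eq: "m - m' = n' - n" using that(1) by (simp add: algebra_simps)
    have "m - m' \<in> M" by (rule complex_vector.subspace_diff[OF M(2) that(2,3)])
    moreover have "n' - n \<in> N" by (rule complex_vector.subspace_diff[OF N(2) that(5,4)])
    ultimately have "m - m' \<in> M \<inter> N" unfolding eq by blast
    then have "m - m' = 0" using 0 by blast
    with eq show ?thesis by simp
  qed
  have "\<forall>x. \<exists>n. n \<in> N \<and> (\<exists>m\<in>M. x = m + n)" using sum by blast
  from choice[OF this] obtain P where P': "\<And>x. P x \<in> N \<and> (\<exists>m\<in>M. x = m + P x)" by blast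
  have dec: "x - P x \<in> M" for x
  proof -
    from P'[of x] obtain m where "m \<in> M" "x = m + P x" by blast
    then have "x - P x = m" by (metis add_diff_cancel_right')
    with \<open>m \<in> M\<close> show ?thesis by simp
  qed
  have P: "P (m + n) = n" if "m \<in> M" "n \<in> N" for m n
    using uniq[of "m + n - P (m + n)" "P (m + n)" m n] dec[of "m + n"] P'[of "m + n"] that by simp
  have add: "P (x + y) = P x + P y" for x y
  proof -
    have "P ((x - P x + (y - P y)) + (P x + P y)) = P x + P y"
      using M(2) N(2) P' dec by (intro P) (auto intro: complex_vector.subspace_add)
    then show ?thesis by (simp add: algebra_simps)
  qed
  have scale: "P (c *\<^sub>C x) = c *\<^sub>C P x" for c x
  proof -
    have "P (c *\<^sub>C (x - P x) + c *\<^sub>C P x) = c *\<^sub>C P x"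
      using M(2) N(2) P' dec by (intro P) (auto intro: complex_vector.subspace_scale)
    then show ?thesis by (simp flip: scaleC_add_right)
  qed
  have TP: "T (P x) = P (T x)" for x
  proof -
    have "P (T (x - P x) + T (P x)) = T (P x)"
      using M(3) N(3) P' dec by (intro P) auto
    then show ?thesis by (simp flip: bounded_clinear_add[OF T])
  qed
  have bl: "bounded_linear (\<lambda>(m, n). m + n :: 'a)"
    by (simp add: case_prod_unfold bounded_linear_add bounded_linear_fst bounded_linear_snd)
  have img: "(\<lambda>(m, n). m + n) ` (M \<times> N) = UNIV" using sum by force
  have "subspace (M \<times> N)"
    using M N by (intro subspace_Times complex_subspace_imp_subspace)
  then obtain C where C: "C > 0" "\<And>y. \<exists>x\<in>M \<times> N. (\<lambda>(m, n). m + n) x = y \<and> norm x \<le> C * norm y"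
    using open_mapping_on[OF bl _ _ , of "M \<times> N"] img M N closed_Times by (metis UNIV_I closed_UNIV)
  have "norm (P x) \<le> norm x * C" for x
  proof -
    obtain m n where "m \<in> M" "n \<in> N" "m + n = x" "norm (m, n) \<le> C * norm x" using C(2)[of x] by auto
    then show ?thesis using P norm_snd_le[of n m] by (auto simp: mult.commute intro: order_trans)
  qed
  then have bc: "bounded_clinear P"
    unfolding bounded_clinear_def
    by (auto intro!: bounded_linear_intro simp: add scale scaleR_scaleC)
  have PN: "P x = x" if "x \<in> N" for x using P[OF complex_vector.subspace_0[OF M(2)] that] by simp
  show ?thesis
  proof
    show "bounded_projection P" using bc P' PN by (auto simp: bounded_projection_def fun_eq_iff)
    show "T \<circ> P = P \<circ> T" using TP by (simp add: fun_eq_iff)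
    show "N = range P"
    proof
      show "N \<subseteq> range P" using PN by (auto intro: range_eqI[OF sym])
    qed (use P' in auto)
    show "M = {x. P x = 0}"
    proof
      show "M \<subseteq> {x. P x = 0}" using P[OF _ complex_vector.subspace_0[OF N(2)]] by auto
      show "{x. P x = 0} \<subseteq> M"
      proof
        fix x assume "x \<in> {x. P x = 0}"
        with dec[of x] show "x \<in> M" by simp
      qed
    qed
  qed
qed

text \<open>Stated for \<open>Suc n\<close> because at exponent 0 the left side is \<open>x\<close>
  and the right side \<open>P x\<close>.\<close>

lemma funpow_comp_projection:
  assumes "bounded_projection P" "T \<circ> P = P \<circ> T"
  shows "((T \<circ> P) ^^ Suc n) x = (T ^^ Suc n) (P x)"
proof (induction n)
  case (Suc n)
  have "((T \<circ> P) ^^ Suc (Suc n)) x = T (P ((T ^^ Suc n) (P x)))" 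
    by (subst funpow.simps(2)) (simp only: comp_apply Suc)
  also have "\<dots> = (T ^^ Suc (Suc n)) (P x)"
    using funpow_commute_eq[OF assms(2)] bounded_projectionD(2)[OF assms(1)]
    by (metis comp_apply funpow.simps(2))
  finally show ?case .
qed simp

text \<open>Positive powers of \<open>T \<circ> P\<close> are powers of \<open>T\<close> after
  \<open>P\<close>, so the two decay conditions differ by the norm bound of \<open>P\<close>, which
  a faster rate absorbs.\<close>

lemma quasinilpotent_on_range_iff:
  assumes T: "bounded_clinear T" and P: "bounded_projection P" and TP: "T \<circ> P = P \<circ> T"
  shows "quasinilpotent_on (range P) T \<longleftrightarrow> quasinilpotent_on UNIV (T \<circ> P)"
proof -
  note P1 = bounded_projectionD[OF P]
  interpret bounded_linear P using P1 bounded_clinear_imp_bounded_linear by blast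
  obtain K where K: "K \<ge> 0" "\<And>x. norm (P x) \<le> norm x * K" using nonneg_bounded by blast
  have 1: "bounded_clinear (T \<circ> P)" using bounded_clinear_comp[OF T P1(1)] by (simp add: comp_def)
  have 2: "0 \<in> range P" using zero by (metis rangeI)
  note pw = funpow_comp_projection[OF P TP]
  show ?thesis
    unfolding quasinilpotent_on_iff[OF T 2] quasinilpotent_on_iff[OF 1 UNIV_I]
  proof (intro iffI allI impI)
    fix e :: real assume e: "e > 0"
    assume "\<forall>e>0. \<forall>\<^sub>F n in sequentially. \<forall>x\<in>range P. norm ((T ^^ n) x) \<le> e ^ n * norm x"
    then have "\<forall>\<^sub>F n in sequentially. \<forall>x\<in>range P. norm ((T ^^ n) x) \<le> (e / 2) ^ n * norm x"
      using e by simp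
    with eventually_le_power[OF e, of K] eventually_gt_at_top[of 0]
    show "\<forall>\<^sub>F n in sequentially. \<forall>x\<in>UNIV. norm (((T \<circ> P) ^^ n) x) \<le> e ^ n * norm x"
    proof eventually_elim
      case (elim n)
      show ?case
      proof
        fix x
        have "((T \<circ> P) ^^ n) x = (T ^^ n) (P x)" using pw[of "n - 1"] elim by simp
        then have "norm (((T \<circ> P) ^^ n) x) \<le> (e / 2) ^ n * norm (P x)" using elim by auto
        also have "\<dots> \<le> (e / 2) ^ n * (norm x * K)" using K e by (intro mult_left_mono) auto
        also have "\<dots> = (K * (e / 2) ^ n) * norm x" by (simp add: mult_ac)
        also have "\<dots> \<le> e ^ n * norm x" using elim by (intro mult_right_mono) auto
        finally show "norm (((T \<circ> P) ^^ n) x) \<le> e ^ n * norm x" .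
      qed
    qed
  next
    fix e :: real assume e: "e > 0"
    assume "\<forall>e>0. \<forall>\<^sub>F n in sequentially. \<forall>x\<in>UNIV. norm (((T \<circ> P) ^^ n) x) \<le> e ^ n * norm x"
    then have "\<forall>\<^sub>F n in sequentially. \<forall>x\<in>UNIV. norm (((T \<circ> P) ^^ n) x) \<le> e ^ n * norm x"
      using e by simp
    with eventually_gt_at_top[of 0] 
    show "\<forall>\<^sub>F n in sequentially. \<forall>x\<in>range P. norm ((T ^^ n) x) \<le> e ^ n * norm x"
    proof eventually_elim
      case (elim n)
      show ?case
      proof
        fix x assume "x \<in> range P"
        then have "P x = x" using range_projection_iff[OF P] by blast
        then have "((T \<circ> P) ^^ n) x = (T ^^ n) x" using pw[of "n - 1" x] elim by simp
        then show "norm ((T ^^ n) x) \<le> e ^ n * norm x" using elim by (metis UNIV_I)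
      qed
    qed
  qed
qed

section \<open>The Hahn--Banach theorem and closed ranges\<close>

text \<open>The two inequalities already force \<open>p (c x) = c p x\<close> for \<open>c \<ge> 0\<close>.\<close>

definition sublinear :: "('a::real_vector \<Rightarrow> real) \<Rightarrow> bool" where
  "sublinear p \<longleftrightarrow> (\<forall>x y. p (x + y) \<le> p x + p y) \<and> (\<forall>c>0. \<forall>x. p (c *\<^sub>R x) \<le> c * p x)"

lemma sublinear_add: "sublinear p \<Longrightarrow> p (x + y) \<le> p x + p y"
  by (simp add: sublinear_def)

lemma sublinear_0: assumes "sublinear p" shows "p 0 = 0"
proof -
  have "p (2 *\<^sub>R 0) \<le> 2 * p 0" "p ((1/2) *\<^sub>R 0) \<le> (1/2) * p 0"
    using assms unfolding sublinear_def by (metis zero_less_numeral, metis half_gt_zero zero_less_one)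
  then show ?thesis by simp
qed

lemma sublinear_scale:
  assumes "sublinear p" "c \<ge> 0" shows "p (c *\<^sub>R x) = c * p x"
proof (cases "c = 0")
  case True then show ?thesis using sublinear_0[OF assms(1)] by simp
next
  case False
  then have c: "c > 0" using assms by simp
  have "p ((1 / c) *\<^sub>R (c *\<^sub>R x)) \<le> (1 / c) * p (c *\<^sub>R x)"
    using assms(1) c unfolding sublinear_def by (metis zero_less_divide_1_iff)
  then have "c * p x \<le> p (c *\<^sub>R x)" using c by (simp add: field_simps)
  moreover have "p (c *\<^sub>R x) \<le> c * p x" using assms(1) c by (simp add: sublinear_def)
  ultimately show ?thesis by simp
qed

lemma sublinear_neg: assumes "sublinear p" shows "- p (- x) \<le> p x"
  using sublinear_add[OF assms, of x "- x"] sublinear_0[OF assms] by simp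

lemma sublinear_odd_imp_linear:
  assumes p: "sublinear p" and odd: "\<And>x. p (- x) \<le> - p x"
  shows "linear p"
proof (rule linearI)
  have neg: "p (- x) = - p x" for x using odd[of x] sublinear_neg[OF p, of "- x"] by simp
  show "p (x + y) = p x + p y" for x y
    using sublinear_add[OF p, of x y] sublinear_add[OF p, of "- x" "- y"] neg[of x] neg[of y] neg[of "x + y"]
    by (simp add: add.commute)
  show "p (c *\<^sub>R x) = c *\<^sub>R p x" for c x
  proof (cases "c \<ge> 0")
    case True then show ?thesis using sublinear_scale[OF p] by simp
  next
    case False
    then have "p ((- c) *\<^sub>R x) = (- c) * p x" by (intro sublinear_scale[OF p]) simp
    then show ?thesis using neg[of "c *\<^sub>R x"] by simp
  qed
qed

text \<open>The infimum defining \<open>q\<close> moves along the ray of \<open>e\<close> at the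
  price \<open>p e\<close> per unit. Subadditivity bounds it below by \<open>- p (- y)\<close>; one
  unit step from \<open>- e\<close> ends at 0, which gives the last claim and makes \<open>q\<close>
  odd at \<open>e\<close>.\<close>

lemma sublinear_improve:
  assumes p: "sublinear p"
  obtains q where "sublinear q" "\<And>y. q y \<le> p y" "q (- e) \<le> - p e"
proof
  define q where "q y = (INF t\<in>{0..}. p (y + t *\<^sub>R e) - t * p e)" for y
  have bdd: "bdd_below ((\<lambda>t. p (y + t *\<^sub>R e) - t * p e) ` {0..})" for y
  proof (rule bdd_belowI2[of _ "- p (- y)"])
    fix t :: real assume "t \<in> {0..}"
    then have "t * p e = p (t *\<^sub>R e)" using sublinear_scale[OF p] by simp
    then show "- p (- y) \<le> p (y + t *\<^sub>R e) - t * p e"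
      using sublinear_add[OF p, of "y + t *\<^sub>R e" "- y"] by simp
  qed
  have le: "q y \<le> p (y + t *\<^sub>R e) - t * p e" if "t \<ge> 0" for y t
    unfolding q_def using that by (intro cINF_lower bdd) simp
  have ge: "c \<le> q y" if "\<And>t. t \<ge> 0 \<Longrightarrow> c \<le> p (y + t *\<^sub>R e) - t * p e" for c y
    unfolding q_def using that by (intro cINF_greatest) auto
  show "q y \<le> p y" for y using le[of 0 y] by simp
  show "q (- e) \<le> - p e" using le[of 1 "- e"] sublinear_0[OF p] by simp
  show "sublinear q"
    unfolding sublinear_def
  proof (intro conjI allI impI)
    fix x y
    have "q (x + y) - (p (x + s *\<^sub>R e) - s * p e) \<le> q y" if s: "s \<ge> 0" for s
    proof (rule ge)
      fix t :: real assume t: "t \<ge> 0"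
      have "q (x + y) \<le> p ((x + y) + (s + t) *\<^sub>R e) - (s + t) * p e"
        using s t by (intro le) simp
      also have "(x + y) + (s + t) *\<^sub>R e = (x + s *\<^sub>R e) + (y + t *\<^sub>R e)"
        by (simp add: algebra_simps)
      also have "p \<dots> \<le> p (x + s *\<^sub>R e) + p (y + t *\<^sub>R e)" by (rule sublinear_add[OF p])
      finally show "q (x + y) - (p (x + s *\<^sub>R e) - s * p e) \<le> p (y + t *\<^sub>R e) - t * p e"
        by (simp add: algebra_simps)
    qed
    then have "q (x + y) - q y \<le> q x" by (intro ge) (simp add: algebra_simps)
    then show "q (x + y) \<le> q x + q y" by simp
  next
    fix c :: real and x assume c: "c > 0"
    have "q (c *\<^sub>R x) / c \<le> q x"
    proof (rule ge)
      fix t :: real assume t: "t \<ge> 0"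
      have "q (c *\<^sub>R x) \<le> p (c *\<^sub>R x + (c * t) *\<^sub>R e) - (c * t) * p e"
        using c t by (intro le) simp
      also have "c *\<^sub>R x + (c * t) *\<^sub>R e = c *\<^sub>R (x + t *\<^sub>R e)" by (simp add: algebra_simps)
      also have "p \<dots> = c * p (x + t *\<^sub>R e)" using c by (intro sublinear_scale[OF p]) simp
      finally show "q (c *\<^sub>R x) / c \<le> p (x + t *\<^sub>R e) - t * p e"
        using c by (simp add: field_simps)
    qed
    then show "q (c *\<^sub>R x) \<le> c * q x" using c by (simp add: field_simps)
  qed
qed

text \<open>Subadditivity passes to the infimum because the smaller of two members of the chain
  serves at \<open>x\<close> and at \<open>y\<close> alike. The common bound
  \<open>- p (- x)\<close> keeps the infimum finite.\<close>

lemma sublinear_Inf_chain: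
  assumes C: "C \<noteq> {}" "\<And>q. q \<in> C \<Longrightarrow> sublinear q \<and> (\<forall>x. q x \<le> p x)"
    and chain: "\<And>q r. q \<in> C \<Longrightarrow> r \<in> C \<Longrightarrow> (\<forall>x. q x \<le> r x) \<or> (\<forall>x. r x \<le> q x)"
  obtains u where "sublinear u" "\<And>q x. q \<in> C \<Longrightarrow> u x \<le> q x"
proof
  define u where "u x = (INF q\<in>C. q x)" for x
  have bdd: "bdd_below ((\<lambda>q. q x) ` C)" for x
  proof (rule bdd_belowI2[of _ "- p (- x)"])
    fix q assume q: "q \<in> C"
    then show "- p (- x) \<le> q x" using C(2)[OF q] sublinear_neg[of q x] by (smt (verit))
  qed
  show le: "u x \<le> q x" if "q \<in> C" for q x
    unfolding u_def using that by (intro cINF_lower bdd)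
  have ge: "c \<le> u x" if "\<And>q. q \<in> C \<Longrightarrow> c \<le> q x" for c x
    unfolding u_def using that C(1) by (intro cINF_greatest)
  show "sublinear u"
    unfolding sublinear_def
  proof (intro conjI allI impI)
    fix x y
    have "u (x + y) - q x \<le> u y" if q: "q \<in> C" for q
    proof (rule ge)
      fix r assume r: "r \<in> C"
      have "\<exists>s\<in>C. s x \<le> q x \<and> s y \<le> r y" using chain[OF q r] q r by fastforce
      then obtain s where s: "s \<in> C" "s x \<le> q x" "s y \<le> r y" by blast
      have "u (x + y) \<le> s (x + y)" by (rule le[OF s(1)])
      also have "\<dots> \<le> s x + s y" using C(2)[OF s(1)] by (intro sublinear_add) simp
      finally show "u (x + y) - q x \<le> r y" using s by simp
    qed
    then have "u (x + y) - u y \<le> u x" by (intro ge) (simp add: algebra_simps)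
    then show "u (x + y) \<le> u x + u y" by simp
  next
    fix c :: real and x assume c: "c > 0"
    have "u (c *\<^sub>R x) / c \<le> u x"
    proof (rule ge)
      fix q assume q: "q \<in> C"
      have "u (c *\<^sub>R x) \<le> q (c *\<^sub>R x)" by (rule le[OF q])
      also have "\<dots> = c * q x" using C(2)[OF q] c by (intro sublinear_scale) auto
      finally show "u (c *\<^sub>R x) / c \<le> q x" using c by (simp add: field_simps)
    qed
    then show "u (c *\<^sub>R x) \<le> c * u x" using c by (simp add: field_simps)
  qed
qed

text \<open>By \<open>sublinear_improve\<close>, a minimal sublinear functional below \<open>p\<close> is odd, hence linear.\<close>

theorem Hahn_Banach_sublinear:
  assumes p: "sublinear p"
  obtains g where "linear g" "\<And>x. g x \<le> p x"
proof -
  define A where "A = {q. sublinear q \<and> (\<forall>x. q x \<le> p x)}"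
  \<comment> \<open>The order is reversed so that the maximal element given by Zorn is a minimal
    functional.\<close>
  define R where "R q r \<longleftrightarrow> (\<forall>x. (r x :: real) \<le> q x)" for q r :: "'a \<Rightarrow> real"
  have "\<exists>m\<in>A. \<forall>a\<in>A. R m a \<longrightarrow> a = m"
  proof (rule predicate_Zorn)
    show "partial_order_on A (relation_of R A)"
      by (rule partial_order_on_relation_ofI) (auto simp: R_def fun_eq_iff intro: order_trans order_antisym)
    fix C assume C: "C \<in> Chains (relation_of R A)"
    then have CA: "C \<subseteq> A" and ch: "\<And>q r. q \<in> C \<Longrightarrow> r \<in> C \<Longrightarrow> R q r \<or> R r q"
      unfolding Chains_def relation_of_def by auto
    show "\<exists>u\<in>A. \<forall>a\<in>C. R a u"
    proof (cases "C = {}")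
      case True then show ?thesis using p by (auto simp: A_def)
    next
      case False
      obtain u where u: "sublinear u" "\<And>q x. q \<in> C \<Longrightarrow> u x \<le> q x"
        by (rule sublinear_Inf_chain[OF False, of p]) (use CA ch in \<open>auto simp: A_def R_def\<close>)
      obtain q where "q \<in> C" using False by blast
      then have "u \<in> A" using u CA by (force simp: A_def intro: order_trans)
      with u show ?thesis by (auto simp: R_def)
    qed
  qed
  then obtain m where m: "m \<in> A" "\<And>a. a \<in> A \<Longrightarrow> R m a \<Longrightarrow> a = m" by blast
  then have subl: "sublinear m" and mp: "\<And>x. m x \<le> p x" by (auto simp: A_def)
  have "m (- e) \<le> - m e" for e
  proof -
    obtain q where q: "sublinear q" "\<And>y. q y \<le> m y" "q (- e) \<le> - m e"
      using sublinear_improve[OF subl] by blast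
    have "q = m" using q mp by (intro m(2)) (auto simp: A_def R_def intro: order_trans)
    with q show ?thesis by simp
  qed
  then show ?thesis using that sublinear_odd_imp_linear[OF subl] mp by blast
qed

text \<open>This is the norm of the quotient by \<open>F\<close>, pulled back to the space. A linear
  functional below it vanishes on \<open>F\<close> and is bounded by the norm.\<close>

lemma sublinear_infdist:
  fixes F :: "'a::real_normed_vector set"
  assumes F: "subspace F"
  shows "sublinear (\<lambda>x. infdist x F)"
proof -
  have ne: "F \<noteq> {}" using F subspace_0 by blast
  have le: "infdist x F \<le> norm (x - a)" if "a \<in> F" for x a
    using infdist_le[OF that] by (simp add: dist_norm)
  have ge: "c \<le> infdist x F" if "\<And>a. a \<in> F \<Longrightarrow> c \<le> norm (x - a)" for c x
    unfolding infdist_notempty[OF ne] using that ne by (intro cINF_greatest) (auto simp: dist_norm)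
  show ?thesis
    unfolding sublinear_def
  proof (intro conjI allI impI)
    fix x y
    have "infdist (x + y) F - norm (x - a) \<le> infdist y F" if a: "a \<in> F" for a
    proof (rule ge)
      fix b assume b: "b \<in> F"
      have "infdist (x + y) F \<le> norm ((x + y) - (a + b))" using a b F by (intro le) (simp add: subspace_add)
      also have "\<dots> \<le> norm (x - a) + norm (y - b)" using norm_triangle_ineq[of "x - a" "y - b"] by (simp add: algebra_simps)
      finally show "infdist (x + y) F - norm (x - a) \<le> norm (y - b)" by simp
    qed
    then have "infdist (x + y) F - infdist y F \<le> infdist x F" by (intro ge) (simp add: algebra_simps)
    then show "infdist (x + y) F \<le> infdist x F + infdist y F" by simp
  next
    fix c :: real and x assume c: "c > 0"
    have "infdist (c *\<^sub>R x) F / c \<le> infdist x F"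
    proof (rule ge)
      fix a assume a: "a \<in> F"
      have "infdist (c *\<^sub>R x) F \<le> norm (c *\<^sub>R x - c *\<^sub>R a)" using a F by (intro le) (simp add: subspace_scale)
      also have "\<dots> = c * norm (x - a)" using c by (simp flip: scaleR_diff_right)
      finally show "infdist (c *\<^sub>R x) F / c \<le> norm (x - a)" using c by (simp add: field_simps)
    qed
    then show "infdist (c *\<^sub>R x) F \<le> c * infdist x F" using c by (simp add: field_simps)
  qed
qed

theorem Hahn_Banach_separate:
  fixes F :: "'a::complex_banach set"
  assumes F: "closed F" "complex_vector.subspace F" and e: "e \<notin> F"
  obtains f :: "'a \<Rightarrow> complex" where "bounded_linear f" "\<And>c x. f (c *\<^sub>C x) = c * f x"
    "\<And>x. x \<in> F \<Longrightarrow> f x = 0" "f e = 1"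
proof -
  have sF: "subspace F" by (rule complex_subspace_imp_subspace[OF F(2)])
  have ne: "F \<noteq> {}" using sF subspace_0 by blast
  \<comment> \<open>Improving the distance at \<open>e\<close> first forces \<open>g e = infdist e F > 0\<close> for every linear \<open>g \<le> q\<close>.\<close>
  obtain q where q: "sublinear q" "\<And>y. q y \<le> infdist y F" "q (- e) \<le> - infdist e F"
    using sublinear_improve[OF sublinear_infdist[OF sF]] by blast
  obtain g where g: "linear g" "\<And>x. g x \<le> q x" using Hahn_Banach_sublinear[OF q(1)] by blast
  interpret g: linear g by (rule g(1))
  have gle: "g y \<le> infdist y F" for y using g(2) q(2) order_trans by blast
  have "infdist e F > 0" using F(1) ne e by (simp add: infdist_pos_not_in_closed)
  moreover have "- g e \<le> - infdist e F" using g(2)[of "- e"] q(3) by (simp add: g.neg)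
  ultimately have ge: "g e > 0" by simp
  have gF: "g y = 0" if "y \<in> F" for y
  proof -
    have "- y \<in> F" using that sF subspace_neg by blast
    then show ?thesis using gle[of y] gle[of "- y"] that by (simp add: g.neg)
  qed
  have "infdist y F \<le> norm y" for y using infdist_le[OF subspace_0[OF sF], of y] by simp
  then have gn: "\<bar>g y\<bar> \<le> norm y" for y
    using gle[of y] gle[of "- y"] by (smt (verit) g.neg norm_minus_cancel)
  \<comment> \<open>The complex-linear functional with real part \<open>g\<close>. It can be
    normalised at \<open>e\<close> because the real part of \<open>h e\<close> is
    \<open>g e > 0\<close>.\<close>
  define h where "h y = Complex (g y) (- g (\<i> *\<^sub>C y))" for y
  have hsc: "h (c *\<^sub>C y) = c * h y" for c y
  proof -
    have 1: "c *\<^sub>C y = Re c *\<^sub>R y + Im c *\<^sub>R (\<i> *\<^sub>C y)"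
      by (simp add: scaleR_scaleC scaleC_scaleC flip: scaleC_add_left) (metis complex_eq mult.commute)
    have 2: "\<i> *\<^sub>C c *\<^sub>C y = Re c *\<^sub>R (\<i> *\<^sub>C y) - Im c *\<^sub>R y"
      by (simp add: scaleR_scaleC scaleC_scaleC flip: complex_vector.scale_left_diff_distrib)
         (simp add: complex_eq_iff)
    show ?thesis
      unfolding h_def 2 unfolding 1
      by (simp add: complex_eq_iff g.add g.diff g.scale)
  qed
  have hadd: "h (x + y) = h x + h y" for x y
    by (simp add: h_def g.add scaleC_add_right complex_eq_iff)
  have hn: "norm (h y) \<le> norm y * 2" for y
  proof -
    have "norm (h y) \<le> \<bar>g y\<bar> + \<bar>g (\<i> *\<^sub>C y)\<bar>"
      using cmod_le[of "h y"] by (simp add: h_def)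
    also have "\<dots> \<le> norm y + norm (\<i> *\<^sub>C y)" using gn add_mono by blast
    finally show ?thesis by (simp add: norm_scaleC)
  qed
  have he: "h e \<noteq> 0" using ge by (simp add: h_def complex_eq_iff)
  have bl: "bounded_linear h"
    by (rule bounded_linear_intro[OF hadd _ hn]) (simp add: scaleR_scaleC hsc scaleR_conv_of_real)
  show ?thesis
  proof
    show "bounded_linear (\<lambda>x. h x / h e)" by (rule bounded_linear_divide[THEN bounded_linear_compose, OF bl])
    show "h (c *\<^sub>C x) / h e = c * (h x / h e)" for c x by (simp add: hsc)
    show "h x / h e = 0" if "x \<in> F" for x
    proof -
      have "h x = 0"
        using gF[OF that] gF[OF complex_vector.subspace_scale[OF F(2) that]]
        by (simp add: h_def complex_eq_iff)
      then show ?thesis by simp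
    qed
    show "h e / h e = 1" using he by simp
  qed
qed

section \<open>Finite dimensional extensions and closed ranges of powers\<close>

lemma closed_span_insert:
  fixes F :: "'a::complex_banach set"
  assumes F: "closed F" "complex_vector.subspace F"
  shows "closed (complex_vector.span (insert v F))"
proof (cases "v \<in> F")
  case True
  then show ?thesis
    using F(1) by (simp add: insert_absorb complex_vector.span_eq_iff[THEN iffD2, OF F(2)])
next
  case False
  obtain f :: "'a \<Rightarrow> complex" where f: "bounded_linear f" "\<And>c x. f (c *\<^sub>C x) = c * f x"
    "\<And>x. x \<in> F \<Longrightarrow> f x = 0" "f v = 1"
    using Hahn_Banach_separate[OF F False] by blast
  interpret bounded_linear f by (rule f(1))
  \<comment> \<open>The coefficient of \<open>v\<close> is read off by the continuous functional
    \<open>f\<close>, so the span is a preimage of \<open>F\<close> under a continuous map.\<close>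
  have "(\<exists>k. x - k *\<^sub>C v \<in> F) \<longleftrightarrow> x - f x *\<^sub>C v \<in> F" for x
  proof
    assume "\<exists>k. x - k *\<^sub>C v \<in> F"
    then obtain k where k: "x - k *\<^sub>C v \<in> F" by blast
    with f(3)[OF k] have "f x = k" by (simp add: diff f)
    with k show "x - f x *\<^sub>C v \<in> F" by simp
  qed blast
  then have "complex_vector.span (insert v F) = {x. x - f x *\<^sub>C v \<in> F}"
    using F(2) by (simp add: complex_vector.span_insert complex_vector.span_eq_iff[THEN iffD2])
  also have "\<dots> = (\<lambda>x. x - f x *\<^sub>C v) -` F" by auto
  also have "closed \<dots>"
  proof (rule closed_vimage[OF F(1)])
    have "bounded_linear (\<lambda>x. f x *\<^sub>C v)"
    proof -
      obtain K where K: "\<And>x. norm (f x) \<le> norm x * K" using bounded by blast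
      show ?thesis
        by (rule bounded_linear_intro[where K="K * norm v"])
           (use K in \<open>auto simp: add scaleC_add_left scaleR_scaleC scaleC_scaleC f norm_scaleC mult_right_mono scaleR\<close>,
            metis K mult.assoc mult_right_mono norm_ge_zero)
    qed
    then show "continuous_on UNIV (\<lambda>x. x - f x *\<^sub>C v)"
      by (intro continuous_intros linear_continuous_on)
  qed
  finally show ?thesis .
qed

lemma closed_span_Un_finite:
  fixes F :: "'a::complex_banach set"
  assumes F: "closed F" "complex_vector.subspace F" and "finite B"
  shows "closed (complex_vector.span (B \<union> F))"
  using \<open>finite B\<close>
proof induction
  case empty then show ?case using F by (simp add: complex_vector.span_eq_iff[THEN iffD2])
next
  case (insert b B)
  have "closed (complex_vector.span (insert b (complex_vector.span (B \<union> F))))"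
    using insert by (intro closed_span_insert) auto
  moreover have "complex_vector.span (insert b (complex_vector.span (B \<union> F))) = complex_vector.span (insert b B \<union> F)"
    by (simp add: complex_vector.span_insert complex_vector.span_span)
  ultimately show ?case by simp
qed

text \<open>Modulo its kernel, \<open>T\<close> is a homeomorphism of \<open>M\<close> onto its
  closed image, and a closed subspace containing the kernel stays closed in the quotient. The proof
  does this by hand, with controlled preimages.\<close>

lemma closed_image_contains_kernel:
  assumes T: "bounded_clinear T" and M: "closed M" "complex_vector.subspace M" "closed (T ` M)"
    and F: "closed F" "complex_vector.subspace F" "F \<subseteq> M" "ker_on M T \<subseteq> F"
  shows "closed (T ` F)"
proof -
  note T' = bounded_clinear_imp_bounded_linear[OF T]
  obtain C where C: "C > 0" "\<And>y. y \<in> T ` M \<Longrightarrow> \<exists>x\<in>M. T x = y \<and> norm x \<le> C * norm y"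
    using open_mapping_on[OF T' M(1) complex_subspace_imp_subspace[OF M(2)] M(3)] by blast
  have "y \<in> T ` F" if y: "y \<in> closure (T ` F)" for y
  proof -
    have "closure (T ` F) \<subseteq> T ` M" using F M by (intro closure_minimal image_mono)
    then obtain z where z: "z \<in> M" "y = T z" using y by blast
    have "z \<in> closure F"
      unfolding closure_approachable
    proof (intro allI impI)
      fix d :: real assume d: "d > 0"
      then obtain x where x: "x \<in> F" "dist (T x) y < d / C"
        using y C(1) unfolding closure_approachable by (metis divide_pos_pos image_iff)
      have "T (x - z) = T x - y" by (simp add: z bounded_clinear_diff[OF T])
      moreover have "x - z \<in> M" using x F z M by (auto intro: complex_vector.subspace_diff)
      ultimately obtain u where u: "u \<in> M" "T u = T x - y" "norm u \<le> C * norm (T x - y)"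
        using C(2) by (metis image_eqI)
      have "u - (x - z) \<in> ker_on M T"
        using u \<open>x - z \<in> M\<close> M \<open>T (x - z) = T x - y\<close>
        by (simp add: ker_on_def bounded_clinear_diff[OF T] complex_vector.subspace_diff)
      \<comment> \<open>This vector is \<open>z + u\<close>: it differs from \<open>x\<close> by a
        kernel element, hence lies in \<open>F\<close>, and it is within \<open>norm u\<close> of
        \<open>z\<close>.\<close>
      then have "u - (x - z) + x \<in> F" using F(4) x(1) by (blast intro: complex_vector.subspace_add[OF F(2)])
      moreover have "norm u < d" using u(3) x(2) C(1) by (simp add: dist_norm field_simps)
      ultimately show "\<exists>w\<in>F. dist w z < d"
        by (intro bexI[of _ "u - (x - z) + x"]) (simp_all add: dist_norm)
    qed
    with F z show ?thesis by simp
  qed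
  then show ?thesis using closure_subset_eq by blast
qed

text \<open>The range of a power may miss part of the kernel, so the kernel is added to it. The sum
  is closed because the kernel is finite dimensional, and \<open>T\<close> maps it onto the same
  image.\<close>

lemma upper_semi_Fredholm_closed_funpow:
  assumes T: "bounded_clinear T" and M: "closed M" "complex_vector.subspace M" "T ` M \<subseteq> M"
    and U: "upper_semi_Fredholm_on M T"
  shows "closed ((T ^^ n) ` M)"
proof (induction n)
  case 0 then show ?case using M by simp
next
  case (Suc n)
  from U obtain B where B: "finite B" "complex_vector.span B = ker_on M T" and cl: "closed (T ` M)"
    unfolding upper_semi_Fredholm_on_def finite_cdim_def by blast
  let ?F = "(T ^^ n) ` M"
  have sF: "complex_vector.subspace ?F"
    using subspace_image_bounded_clinear[OF bounded_clinear_funpow[OF T] M(2)] .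
  have FM: "?F \<subseteq> M" using funpow_in_invariant[OF _ M(3)] by blast
  have kM: "ker_on M T \<subseteq> M" by (auto simp: ker_on_def)
  let ?G = "complex_vector.span (B \<union> ?F)"
  have G: "?G = {x + y |x y. x \<in> ker_on M T \<and> y \<in> ?F}"
    unfolding complex_vector.span_Un B(2) using sF by (simp add: complex_vector.span_eq_iff[THEN iffD2])
  have "closed (T ` ?G)"
  proof (rule closed_image_contains_kernel[OF T M(1,2) cl])
    show "closed ?G" by (rule closed_span_Un_finite[OF Suc sF B(1)])
    show "?G \<subseteq> M" unfolding G using kM FM M(2) by (auto intro: complex_vector.subspace_add)
    show "ker_on M T \<subseteq> ?G" unfolding B(2)[symmetric] by (rule complex_vector.span_mono) simp
  qed simp
  also have "T ` ?G = T ` ?F"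
  proof
    show "T ` ?G \<subseteq> T ` ?F" unfolding G
      by (auto simp: bounded_clinear_add[OF T] ker_on_def)
    show "T ` ?F \<subseteq> T ` ?G" by (intro image_mono order_trans[OF _ complex_vector.span_superset]) simp
  qed
  also have "T ` ?F = (T ^^ Suc n) ` M" by (simp add: image_comp)
  finally show ?case .
qed

section \<open>Shifts of bounded below and of Kato operators\<close>

lemma bounded_clinear_shift:
  "bounded_clinear T \<Longrightarrow> bounded_clinear (\<lambda>x. T x - z *\<^sub>C x)"
  by (intro bounded_clinear_minus bounded_clinear_scale)

text \<open>\<open>T ^^ n\<close> minus \<open>z ^ n\<close> factors as a polynomial in
  \<open>T\<close> times \<open>T - z\<close>; the induction keeps track of a bound for the
  polynomial factor.\<close>

lemma funpow_minus_power_bound: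
  assumes T: "bounded_clinear T"
  shows "\<exists>K\<ge>0. \<forall>x. norm ((T ^^ n) x - z ^ n *\<^sub>C x) \<le> K * norm (T x - z *\<^sub>C x)"
proof (induction n)
  case 0 then show ?case by (intro exI[of _ 0]) (simp add: scaleC_one)
next
  case (Suc n)
  then obtain K where K: "K \<ge> 0" "\<And>x. norm ((T ^^ n) x - z ^ n *\<^sub>C x) \<le> K * norm (T x - z *\<^sub>C x)" by blast
  obtain L where L: "L \<ge> 0" "\<And>x. norm (T x) \<le> norm x * L"
    using bounded_linear.nonneg_bounded[OF bounded_clinear_imp_bounded_linear[OF T]] by blast
  show ?case
  proof (intro exI[of _ "K * L + cmod z ^ n"] conjI allI)
    show "K * L + cmod z ^ n \<ge> 0" using K L by simp
    fix x
    have "(T ^^ Suc n) x - z ^ Suc n *\<^sub>C x = T ((T ^^ n) x - z ^ n *\<^sub>C x) + z ^ n *\<^sub>C (T x - z *\<^sub>C x)"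
      by (simp add: bounded_clinear_diff[OF T] bounded_clinear_scaleC[OF T]
          complex_vector.scale_right_diff_distrib scaleC_scaleC mult.commute)
    also have "norm \<dots> \<le> norm ((T ^^ n) x - z ^ n *\<^sub>C x) * L + cmod z ^ n * norm (T x - z *\<^sub>C x)"
      by (intro norm_triangle_le add_mono L(2)) (simp add: norm_scaleC norm_power)
    also have "\<dots> \<le> K * norm (T x - z *\<^sub>C x) * L + cmod z ^ n * norm (T x - z *\<^sub>C x)"
      using K(2)[of x] L(1) by (intro add_mono mult_right_mono) auto
    finally show "norm ((T ^^ Suc n) x - z ^ Suc n *\<^sub>C x) \<le> (K * L + cmod z ^ n) * norm (T x - z *\<^sub>C x)"
      by (simp add: algebra_simps)
  qed
qed

text \<open>For some positive \<open>n\<close>, the power \<open>T ^^ n\<close> is on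
  \<open>N\<close> at most half as large as \<open>z ^ n\<close>, so their difference is bounded
  below; \<open>funpow_minus_power_bound\<close> passes this on to \<open>T - z\<close>.\<close>

lemma quasinilpotent_shift_bounded_below:
  assumes T: "bounded_clinear T" and N: "0 \<in> N" and q: "quasinilpotent_on N T" and z: "z \<noteq> 0"
  shows "bounded_below_on N (\<lambda>x. T x - z *\<^sub>C x)"
proof -
  have "cmod z / 2 > 0" using z by simp
  then have "\<forall>\<^sub>F n in sequentially. \<forall>x\<in>N. norm ((T ^^ n) x) \<le> (cmod z / 2) ^ n * norm x"
    using q unfolding quasinilpotent_on_iff[OF T N] by blast
  then have "\<forall>\<^sub>F n in sequentially. (\<forall>x\<in>N. norm ((T ^^ n) x) \<le> (cmod z / 2) ^ n * norm x) \<and> n > 0"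
    using eventually_gt_at_top[of 0] by (rule eventually_conj)
  from eventually_happens'[OF sequentially_bot this]
  obtain n where n: "\<And>x. x \<in> N \<Longrightarrow> norm ((T ^^ n) x) \<le> (cmod z / 2) ^ n * norm x" "n > 0"
    by blast
  obtain K where K: "K \<ge> 0" "\<And>x. norm ((T ^^ n) x - z ^ n *\<^sub>C x) \<le> K * norm (T x - z *\<^sub>C x)"
    using funpow_minus_power_bound[OF T] by blast
  define a where "a = cmod z ^ n"
  have a: "a > 0" using z by (simp add: a_def)
  have "(2::real) ^ 1 \<le> 2 ^ n" using n(2) by (intro power_increasing) auto
  then have "a / 2 ^ n \<le> a / 2" using a by (intro divide_left_mono) auto
  then have a2: "(cmod z / 2) ^ n \<le> a / 2" by (simp only: a_def power_divide)
  show ?thesis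
    unfolding bounded_below_on_def
  proof (intro exI[of _ "a / (2 * (K + 1))"] conjI ballI)
    show "a / (2 * (K + 1)) > 0" using a K by simp
    fix x assume x: "x \<in> N"
    have "a * norm x = norm (z ^ n *\<^sub>C x)" by (simp add: a_def norm_scaleC norm_power)
    also have "\<dots> \<le> norm ((T ^^ n) x) + norm ((T ^^ n) x - z ^ n *\<^sub>C x)"
      using norm_triangle_ineq4[of "(T ^^ n) x" "(T ^^ n) x - z ^ n *\<^sub>C x"] by simp
    also have "\<dots> \<le> a / 2 * norm x + K * norm (T x - z *\<^sub>C x)"
      using order_trans[OF n(1)[OF x] mult_right_mono[OF a2 norm_ge_zero]] K(2) by (rule add_mono)
    also have "\<dots> \<le> a / 2 * norm x + (K + 1) * norm (T x - z *\<^sub>C x)"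
      by (simp add: distrib_right)
    finally have "a / 2 * norm x \<le> (K + 1) * norm (T x - z *\<^sub>C x)" by simp
    then show "a / (2 * (K + 1)) * norm x \<le> norm (T x - z *\<^sub>C x)"
      using K(1) by (simp add: field_simps)
  qed
qed

lemma bounded_below_shift:
  assumes "bounded_below_on M T"
  obtains d where "d > 0" "\<And>z. cmod z < d \<Longrightarrow> bounded_below_on M (\<lambda>x. T x - z *\<^sub>C x)"
proof -
  from assms obtain c where c: "c > 0" "\<And>x. x \<in> M \<Longrightarrow> c * norm x \<le> norm (T x)"
    by (auto simp: bounded_below_on_def)
  show ?thesis
  proof
    show "c > 0" by (rule c)
    fix z assume z: "cmod z < c"
    show "bounded_below_on M (\<lambda>x. T x - z *\<^sub>C x)"
      unfolding bounded_below_on_def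
    proof (intro exI[of _ "c - cmod z"] conjI ballI)
      show "c - cmod z > 0" using z by simp
      fix x assume "x \<in> M"
      with c(2)[of x] norm_triangle_ineq2[of "T x" "z *\<^sub>C x"]
      show "(c - cmod z) * norm x \<le> norm (T x - z *\<^sub>C x)"
        by (simp add: norm_scaleC left_diff_distrib)
    qed
  qed
qed

lemma bounded_below_direct_sum:
  assumes S: "bounded_clinear S" and P: "bounded_projection P" and SP: "\<And>x. S (P x) = P (S x)"
    and M: "bounded_below_on {x. P x = 0} S" and N: "bounded_below_on (range P) S"
  shows "bounded_below_on UNIV S"
proof -
  note P1 = bounded_projectionD[OF P]
  obtain L where L: "L \<ge> 0" "\<And>x. norm (P x) \<le> norm x * L"
    using bounded_linear.nonneg_bounded[OF bounded_clinear_imp_bounded_linear[OF P1(1)]] by blast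
  obtain c where c: "c > 0" "\<And>x. P x = 0 \<Longrightarrow> c * norm x \<le> norm (S x)"
    using M by (auto simp: bounded_below_on_def)
  obtain d where d: "d > 0" "\<And>x. d * norm (P x) \<le> norm (S (P x))"
    using N by (auto simp: bounded_below_on_def)
  define K where "K = (1 + L) / c + L / d + 1"
  have K: "K > 0" using c d L by (simp add: K_def add_nonneg_pos)
  show ?thesis
    unfolding bounded_below_on_def
  proof (intro exI[of _ "1 / K"] conjI ballI)
    show "1 / K > 0" using K by simp
    fix x
    have "c * norm (x - P x) \<le> norm (S (x - P x))"
      by (rule c(2)) (simp add: bounded_clinear_diff[OF P1(1)] P1(2))
    also have "S (x - P x) = S x - P (S x)" by (simp add: bounded_clinear_diff[OF S] SP)
    also have "norm \<dots> \<le> norm (S x) * (1 + L)"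
      using norm_triangle_ineq4[of "S x" "P (S x)"] L(2)[of "S x"] by (simp add: distrib_left)
    finally have 1: "norm (x - P x) \<le> norm (S x) * ((1 + L) / c)" using c(1) by (simp add: field_simps)
    have "d * norm (P x) \<le> norm (S x) * L"
      using order_trans[OF d(2)[of x]] L(2)[of "S x"] by (simp add: SP)
    then have 2: "norm (P x) \<le> norm (S x) * (L / d)" using d(1) by (simp add: field_simps)
    have "norm x \<le> norm (x - P x) + norm (P x)" using norm_triangle_ineq[of "x - P x" "P x"] by simp
    also have "\<dots> \<le> norm (S x) * ((1 + L) / c) + norm (S x) * (L / d)" using 1 2 by (rule add_mono)
    also have "\<dots> \<le> norm (S x) * K" by (simp add: K_def distrib_left)
    finally show "1 / K * norm x \<le> norm (S x)" using K by (simp add: field_simps)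
  qed
qed

lemma bounded_below_on_cong:
  "(\<And>x. x \<in> Y \<Longrightarrow> S x = T x) \<Longrightarrow> bounded_below_on Y S \<longleftrightarrow> bounded_below_on Y T"
  by (simp add: bounded_below_on_def)

lemma ascent_on_finite_iff:
  "ascent_on Y S < \<infinity> \<longleftrightarrow> (\<exists>n. ker_on Y (S ^^ n) = ker_on Y (S ^^ Suc n))"
  unfolding ascent_on_def INF_less_iff by simp

lemma bounded_below_on_imp_upper_semi_Browder_on:
  assumes T: "bounded_clinear T" and M: "closed M" "complex_vector.subspace M" and bb: "bounded_below_on M T"
  shows "upper_semi_Browder_on M T"
proof -
  have *: "closed (T ` M)" "ker_on M T = {0}"
    using bb bounded_below_on_iff[OF bounded_clinear_imp_bounded_linear[OF T] M(1) complex_subspace_imp_subspace[OF M(2)]]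
    by auto
  have "finite_cdim {0::'a}"
    unfolding finite_cdim_def by (intro exI[of _ "{}"]) (simp add: complex_vector.span_empty)
  moreover have "ker_on M (T ^^ 0) = ker_on M (T ^^ Suc 0)"
    using * complex_vector.subspace_0[OF M(2)] by (auto simp: ker_on_def)
  ultimately show ?thesis
    using * unfolding upper_semi_Browder_on_def upper_semi_Fredholm_on_def ascent_on_finite_iff by metis
qed

lemma bounded_below_on_imp_Kato_on:
  assumes T: "bounded_clinear T" and M: "closed M" "complex_vector.subspace M" and bb: "bounded_below_on M T"
  shows "Kato_on M T"
proof -
  have *: "closed (T ` M)" "ker_on M T = {0}"
    using bb bounded_below_on_iff[OF bounded_clinear_imp_bounded_linear[OF T] M(1) complex_subspace_imp_subspace[OF M(2)]]
    by auto
  have "0 \<in> (T ^^ n) ` M" for n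
    by (rule complex_vector.subspace_0[OF subspace_image_bounded_clinear[OF bounded_clinear_funpow[OF T] M(2)]])
  with * show ?thesis by (simp add: Kato_on_def)
qed

text \<open>A Neumann series for a right inverse. The choice \<open>g\<close> of preimages may be
  nonlinear, so the series is built from its iterates at the single point \<open>y\<close>. The
  condition on \<open>z\<close> gives ratio 1/2, whence the factor 2.\<close>

lemma surjective_on_shift:
  assumes T: "bounded_clinear T" and W: "closed W" "complex_vector.subspace W"
    and C: "C > 0" "\<And>y. y \<in> W \<Longrightarrow> \<exists>x\<in>W. T x = y \<and> norm x \<le> C * norm y"
    and z: "cmod z * C \<le> 1/2" and y: "y \<in> W"
  shows "\<exists>x\<in>W. T x - z *\<^sub>C x = y \<and> norm x \<le> 2 * C * norm y"
proof -
  from C(2) obtain g where g: "\<And>y. y \<in> W \<Longrightarrow> g y \<in> W \<and> T (g y) = y \<and> norm (g y) \<le> C * norm y" by metis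
  define w where "w k = (g ^^ k) y" for k
  have w: "w k \<in> W \<and> norm (w k) \<le> C ^ k * norm y" for k
  proof (induction k)
    case 0 then show ?case using y by (simp add: w_def)
  next
    case (Suc k)
    then have "norm (g (w k)) \<le> C * norm (w k)" "g (w k) \<in> W" using g by blast+
    moreover have "C * norm (w k) \<le> C * (C ^ k * norm y)" using Suc C by (intro mult_left_mono) auto
    ultimately show ?case by (simp add: w_def mult.assoc)
  qed
  have Tw: "T (w (Suc k)) = w k" for k using g w by (simp add: w_def)
  \<comment> \<open>Since \<open>T (w (Suc k)) = w k\<close>, the series with terms \<open>a k\<close> telescopes under \<open>T - z\<close> to \<open>w 0 = y\<close>.\<close>
  define a where "a k = z ^ k *\<^sub>C w (Suc k)" for k
  have pw: "cmod z ^ k * (C ^ k * norm y) \<le> norm y * (1/2) ^ k" for k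
  proof -
    have "(cmod z * C) ^ k \<le> (1/2) ^ k" using z C by (intro power_mono) auto
    then have "norm y * (cmod z * C) ^ k \<le> norm y * (1/2) ^ k" by (intro mult_left_mono) auto
    then show ?thesis by (simp add: power_mult_distrib mult_ac)
  qed
  have an: "norm (a k) \<le> (C * norm y) * (1/2) ^ k" for k
  proof -
    have "norm (a k) = cmod z ^ k * norm (w (Suc k))" by (simp add: a_def norm_scaleC norm_power)
    also have "\<dots> \<le> cmod z ^ k * (C ^ Suc k * norm y)" 
      by (intro mult_left_mono conjunct2[OF w]) simp
    also have "\<dots> = C * (cmod z ^ k * (C ^ k * norm y))" by simp
    also have "\<dots> \<le> C * (norm y * (1/2) ^ k)" using pw C by (intro mult_left_mono) auto
    finally show ?thesis by (simp add: mult.assoc)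
  qed
  have sumn: "summable (\<lambda>n. (C * norm y) * (1/2) ^ n)" by (intro summable_mult summable_geometric) simp
  have sm: "summable (\<lambda>n. norm (a n))"
    by (rule summable_comparison_test'[OF sumn]) (use an in auto)
  then have sm': "summable a" by (rule summable_norm_cancel)
  have lim: "(\<lambda>n. \<Sum>i<n. a i) \<longlonglongrightarrow> suminf a" using sm' by (rule summable_LIMSEQ)
  have "a k \<in> W" for k unfolding a_def by (intro complex_vector.subspace_scale[OF W(2)] conjunct1[OF w])
  then have xW: "suminf a \<in> W"
    by (intro closed_sequentially[OF W(1) _ lim] complex_vector.subspace_sum[OF W(2)])
  have "norm (suminf a) \<le> (\<Sum>n. (C * norm y) * (1/2) ^ n)"
    by (rule order_trans[OF summable_norm[OF sm] suminf_le[OF an sm sumn]])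
  also have "\<dots> = 2 * C * norm y"
    by (subst suminf_mult) (auto simp: suminf_geometric summable_geometric)
  finally have nx: "norm (suminf a) \<le> 2 * C * norm y" .
  note S = bounded_clinear_shift[OF T, of z]
  have part: "T (\<Sum>i<n. a i) - z *\<^sub>C (\<Sum>i<n. a i) = y - z ^ n *\<^sub>C w n" for n
  proof (induction n)
    case 0 then show ?case
      by (simp add: w_def scaleC_one bounded_clinear_0[OF T] complex_vector.scale_zero_right)
  next
    case (Suc n)
    have "T (a n) = z ^ n *\<^sub>C w n" by (simp add: a_def bounded_clinear_scaleC[OF T] Tw)
    moreover have "z *\<^sub>C a n = z ^ Suc n *\<^sub>C w (Suc n)" by (simp add: a_def scaleC_scaleC)
    ultimately show ?case using Suc by (simp add: bounded_clinear_add[OF T] scaleC_add_right algebra_simps)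
  qed
  have "(\<lambda>n. norm y * (1/2) ^ n) \<longlonglongrightarrow> norm y * 0"
    by (intro tendsto_intros LIMSEQ_power_zero) simp
  then have bnd: "(\<lambda>n. norm y * (1/2) ^ n) \<longlonglongrightarrow> 0" by simp
  have wn: "norm (z ^ n *\<^sub>C w n) \<le> norm y * (1/2) ^ n" for n
    using order_trans[OF mult_left_mono[OF conjunct2[OF w]] pw] by (simp add: norm_scaleC norm_power)
  have "(\<lambda>n. z ^ n *\<^sub>C w n) \<longlonglongrightarrow> 0"
    by (rule Lim_null_comparison[OF _ bnd]) (intro always_eventually allI wn)
  then have "(\<lambda>n. y - z ^ n *\<^sub>C w n) \<longlonglongrightarrow> y - 0" by (rule tendsto_diff[OF tendsto_const])
  then have "(\<lambda>n. T (\<Sum>i<n. a i) - z *\<^sub>C (\<Sum>i<n. a i)) \<longlonglongrightarrow> y" unfolding part by simp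
  with bounded_linear.tendsto[OF bounded_clinear_imp_bounded_linear[OF S] lim]
  have "T (suminf a) - z *\<^sub>C suminf a = y" by (rule LIMSEQ_unique)
  with xW nx show ?thesis by blast
qed

text \<open>The Kato condition places the kernel inside the range of every power, so
  \<open>closed_image_contains_kernel\<close> applies at each step of the induction.\<close>

lemma Kato_on_closed_funpow:
  assumes T: "bounded_clinear T" and M: "closed M" "complex_vector.subspace M" "T ` M \<subseteq> M" and K: "Kato_on M T"
  shows "closed ((T ^^ n) ` M)"
proof (induction n)
  case 0 then show ?case using M by simp
next
  case (Suc n)
  have "closed (T ` ((T ^^ n) ` M))"
  proof (rule closed_image_contains_kernel[OF T M(1,2)])
    show "closed (T ` M)" "ker_on M T \<subseteq> (T ^^ n) ` M" using K by (auto simp: Kato_on_def)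
    show "complex_vector.subspace ((T ^^ n) ` M)"
      using subspace_image_bounded_clinear[OF bounded_clinear_funpow[OF T] M(2)] .
    show "(T ^^ n) ` M \<subseteq> M" using funpow_in_invariant[OF _ M(3)] by blast
  qed fact
  then show ?case by (simp add: image_comp)
qed

lemma Kato_on_shift_finite_ascent:
  assumes T: "bounded_clinear T" and M: "closed M" "complex_vector.subspace M" "T ` M \<subseteq> M" and K: "Kato_on M T"
  obtains d where "d > 0"
    "\<And>z. cmod z < d \<Longrightarrow> ascent_on UNIV (\<lambda>x. T x - z *\<^sub>C x) < \<infinity> \<Longrightarrow> bounded_below_on M T"
proof -
  have cl: "closed (T ` M)" and ker: "\<And>n. ker_on M T \<subseteq> (T ^^ n) ` M" using K by (auto simp: Kato_on_def)
  note T' = bounded_clinear_imp_bounded_linear[OF T]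
  note M' = M(1) complex_subspace_imp_subspace[OF M(2)]
  obtain C where C: "C > 0" "\<And>y. y \<in> T ` M \<Longrightarrow> \<exists>x\<in>M. T x = y \<and> norm x \<le> C * norm y"
    using open_mapping_on[OF T' M' cl] by blast
  define W where "W = (\<Inter>n. (T ^^ n) ` M)"
  have sub: "complex_vector.subspace ((T ^^ n) ` M)" for n
    using subspace_image_bounded_clinear[OF bounded_clinear_funpow[OF T] M(2)] .
  have W: "closed W" "complex_vector.subspace W"
    unfolding W_def using Kato_on_closed_funpow[OF T M K] sub
    by (auto intro: complex_vector.subspace_Inter)
  have kW: "ker_on M T \<subseteq> W" using ker by (auto simp: W_def)
  have surj: "\<exists>x\<in>W. T x = y \<and> norm x \<le> C * norm y" if y: "y \<in> W" for y
  proof -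
    have "y \<in> (T ^^ 1) ` M" using y unfolding W_def by blast
    then have "y \<in> T ` M" by simp
    then obtain x where x: "x \<in> M" "T x = y" "norm x \<le> C * norm y" using C by blast
    \<comment> \<open>Any preimage in \<open>M\<close> of a point of \<open>W\<close> lies in
      \<open>W\<close>: it differs from a value of \<open>T ^^ n\<close> by a kernel element, itself
      such a value. So the constant \<open>C\<close> obtained on \<open>M\<close> serves on
      \<open>W\<close>.\<close>
    have "x \<in> (T ^^ n) ` M" for n
    proof -
      have "y \<in> (T ^^ Suc n) ` M" using y unfolding W_def by blast
      then obtain u where u: "u \<in> M" "y = T ((T ^^ n) u)" by auto
      have "x - (T ^^ n) u \<in> ker_on M T"
        using x u funpow_in_invariant[OF u(1) M(3)]
        by (auto simp: ker_on_def bounded_clinear_diff[OF T] intro: complex_vector.subspace_diff[OF M(2)])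
      then have "x - (T ^^ n) u + (T ^^ n) u \<in> (T ^^ n) ` M"
        using ker u by (intro complex_vector.subspace_add[OF sub]) auto
      then show ?thesis by simp
    qed
    with x show ?thesis by (auto simp: W_def)
  qed
  show ?thesis
  proof
    \<comment> \<open>Half of what \<open>surjective_on_shift\<close> allows: with
      \<open>S u = x\<close> and \<open>norm u \<le> 2 * C * norm x\<close>, the equation
      \<open>x + z *\<^sub>C u = 0\<close> then gives
      \<open>norm x \<le> norm x / 2\<close>.\<close>
    show "1 / (4 * C) > 0" using C by simp
    fix z assume z: "cmod z < 1 / (4 * C)" and asc: "ascent_on UNIV (\<lambda>x. T x - z *\<^sub>C x) < \<infinity>"
    define S where "S x = T x - z *\<^sub>C x" for x
    have S: "bounded_clinear S" unfolding S_def by (rule bounded_clinear_shift[OF T])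
    have zC: "cmod z * C \<le> 1/4" using z C by (simp add: field_simps)
    then have zC2: "cmod z * C \<le> 1/2" by simp
    have Ssurj: "\<exists>x\<in>W. S x = y \<and> norm x \<le> 2 * C * norm y" if "y \<in> W" for y
      unfolding S_def by (rule surjective_on_shift[OF T W C(1) surj zC2 that])
    have Spow: "\<exists>x\<in>W. (S ^^ n) x = y" if "y \<in> W" for n y
      using that
    proof (induction n arbitrary: y)
      case (Suc n)
      then obtain v where v: "v \<in> W" "S v = y" using Ssurj by blast
      from Suc.IH[OF v(1)] obtain x where "x \<in> W" "(S ^^ n) x = v" by blast
      with v show ?case by (intro bexI[of _ x]) auto
    qed auto
    obtain n where n: "ker_on UNIV (S ^^ n) = ker_on UNIV (S ^^ Suc n)"
      using asc unfolding ascent_on_finite_iff S_def by blast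
    \<comment> \<open>A kernel vector of \<open>S\<close> in \<open>W\<close> is pulled back through
      \<open>S ^^ n\<close> to a vector killed by \<open>S ^^ Suc n\<close>; stabilised kernels make
      \<open>S ^^ n\<close> kill it already.\<close>
    have inj: "x = 0" if x: "x \<in> W" "S x = 0" for x
    proof -
      obtain u where u: "(S ^^ n) u = x" using Spow[OF x(1)] by blast
      then have "u \<in> ker_on UNIV (S ^^ Suc n)" using x by (simp add: ker_on_def)
      then have "u \<in> ker_on UNIV (S ^^ n)" using n by simp
      with u show ?thesis by (simp add: ker_on_def)
    qed
    have "x = 0" if x: "x \<in> ker_on M T" for x
    proof -
      have xW: "x \<in> W" using kW x by blast
      obtain u where u: "u \<in> W" "S u = x" "norm u \<le> 2 * C * norm x" using Ssurj[OF xW] by blast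
      have "S (x + z *\<^sub>C u) = S x + z *\<^sub>C x"
        by (simp add: bounded_clinear_add[OF S] bounded_clinear_scaleC[OF S] u)
      also have "\<dots> = 0" using x by (simp add: S_def ker_on_def)
      finally have "x + z *\<^sub>C u = 0"

        by (rule inj[OF complex_vector.subspace_add[OF W(2) xW complex_vector.subspace_scale[OF W(2) u(1)]]])
      then have "norm x = norm (z *\<^sub>C u)" by (metis add_eq_0_iff norm_minus_cancel)
      also have "\<dots> \<le> cmod z * (2 * C * norm x)" using u(3) by (simp add: norm_scaleC mult_left_mono)
      also have "\<dots> = (cmod z * C) * (2 * norm x)" by simp
      also have "\<dots> \<le> 1/4 * (2 * norm x)" using zC by (intro mult_right_mono) auto
      finally show "x = 0" by simp
    qed
    moreover have "0 \<in> ker_on M T"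
      using complex_vector.subspace_0[OF M(2)] by (simp add: ker_on_def bounded_clinear_0[OF T])
    ultimately have "ker_on M T = {0}" by blast
    with cl show "bounded_below_on M T" by (simp add: bounded_below_on_iff[OF T' M'])
  qed
qed

section \<open>Splitting off the kernel of an upper semi-Browder operator\<close>

text \<open>The cardinality clause provides the measure for the splitting induction: a vector of the
  span of \<open>B\<close> outside \<open>V\<close> can be adjoined to a basis of \<open>V\<close>
  with independence preserved.\<close>

lemma complex_subspace_basis:
  fixes V :: "'a::complex_banach set"
  assumes V: "complex_vector.subspace V" and "finite B" "V \<subseteq> complex_vector.span B"
  obtains A where "finite A" "A \<subseteq> V" "complex_vector.span A = V"
    "V \<noteq> complex_vector.span B \<Longrightarrow> card A < card B"
proof -
  obtain A where A: "A \<subseteq> V" "complex_vector.independent A" "V \<subseteq> complex_vector.span A"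
    using complex_vector.maximal_independent_subset by blast
  have sp: "complex_vector.span A = V" using complex_vector.span_subspace[OF A(1,3) V] .
  have fin: "finite A"
    using complex_vector.independent_span_bound[OF \<open>finite B\<close> A(2)] A(1) assms(3) by blast
  have "card A < card B" if ne: "V \<noteq> complex_vector.span B"
  proof -
    obtain e where e: "e \<in> complex_vector.span B" "e \<notin> V" using ne assms(3) by blast
    have "e \<notin> A" using e A(1) by blast
    have "complex_vector.independent (insert e A)"
      using e(2) A(2) by (intro complex_vector.independent_insertI) (simp_all add: sp)
    moreover have "insert e A \<subseteq> complex_vector.span B" using e A(1) assms(3) by blast
    ultimately have "card (insert e A) \<le> card B"
      using complex_vector.independent_span_bound[OF \<open>finite B\<close>] by blast
    with fin \<open>e \<notin> A\<close> show ?thesis by simp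
  qed
  with fin A(1) sp show ?thesis by (rule that)
qed

lemma finite_cdim_subspace:
  assumes "complex_vector.subspace V" "finite_cdim W" "V \<subseteq> W"
  shows "finite_cdim V"
proof -
  from assms(2) obtain B where B: "finite B" "complex_vector.span B = W" by (auto simp: finite_cdim_def)
  have "V \<subseteq> complex_vector.span B" using assms(3) B(2) by simp
  then obtain A where "finite A" "A \<subseteq> V" "complex_vector.span A = V"
    using complex_subspace_basis[OF assms(1) B(1)] by metis
  then show ?thesis by (auto simp: finite_cdim_def)
qed

lemma funpow_cong_on:
  assumes "\<And>x. x \<in> M \<Longrightarrow> S x = T x" "T ` M \<subseteq> M" "x \<in> M"
  shows "(S ^^ n) x = (T ^^ n) x"
proof (induction n)
  case (Suc n)
  then show ?case using assms(1)[OF funpow_in_invariant[OF assms(3,2)]] by simp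
qed simp

lemma upper_semi_Browder_on_cong:
  assumes eq: "\<And>x. x \<in> M \<Longrightarrow> S x = T x" and M: "T ` M \<subseteq> M"
  shows "upper_semi_Browder_on M S \<longleftrightarrow> upper_semi_Browder_on M T"
proof -
  have "S ` M = T ` M" using eq by (rule image_cong[OF refl])
  moreover have "ker_on M S = ker_on M T" using eq by (auto simp: ker_on_def)
  moreover have "ker_on M (S ^^ n) = ker_on M (T ^^ n)" for n
    using funpow_cong_on[of M S T, OF eq M] by (auto simp: ker_on_def)
  ultimately show ?thesis
    unfolding upper_semi_Browder_on_def upper_semi_Fredholm_on_def ascent_on_finite_iff by (simp del: funpow.simps)
qed

text \<open>If \<open>S u\<close> lies in the kernel of \<open>R\<close>, then
  \<open>u - R u\<close> is a preimage of it in that kernel. So the range is the old range cut by a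
  closed set; the kernels of powers are cut likewise and stabilise at the same index.\<close>

lemma upper_semi_Browder_on_restrict:
  assumes S: "bounded_clinear S" and M: "complex_vector.subspace M" and R: "bounded_projection R"
    and SR: "\<And>x. S (R x) = R (S x)" and RM: "R ` M \<subseteq> M" and U: "upper_semi_Browder_on M S"
  shows "upper_semi_Browder_on (M \<inter> {x. R x = 0}) S"
proof -
  note R1 = bounded_projectionD[OF R]
  let ?M = "M \<inter> {x. R x = 0}"
  have "continuous_on UNIV R"
    using R1(1) bounded_clinear_imp_bounded_linear linear_continuous_on by blast
  then have "closed {x. R x = 0}" by (intro closed_Collect_eq continuous_intros)
  moreover have "S ` ?M = S ` M \<inter> {x. R x = 0}"
  proof
    show "S ` ?M \<subseteq> S ` M \<inter> {x. R x = 0}" by (auto simp: SR[symmetric] bounded_clinear_0[OF S])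
    show "S ` M \<inter> {x. R x = 0} \<subseteq> S ` ?M"
    proof
      fix y assume "y \<in> S ` M \<inter> {x. R x = 0}"
      then obtain u where u: "u \<in> M" "y = S u" "R (S u) = 0" by auto
      have "u - R u \<in> M" using u RM by (intro complex_vector.subspace_diff[OF M]) auto
      moreover have "R (u - R u) = 0" by (simp add: bounded_clinear_diff[OF R1(1)] R1(2))
      moreover have "y = S (u - R u)" by (simp add: bounded_clinear_diff[OF S] SR u)
      ultimately show "y \<in> S ` ?M" by blast
    qed
  qed
  ultimately have cl: "closed (S ` ?M)"
    using U by (auto simp: upper_semi_Browder_on_def upper_semi_Fredholm_on_def intro: closed_Int)
  have "complex_vector.subspace ?M"
    using M subspace_ker_on[OF R1(1) complex_vector.subspace_UNIV]
    by (intro complex_vector.subspace_inter) (auto simp: ker_on_def)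
  then have "complex_vector.subspace (ker_on ?M S)" by (rule subspace_ker_on[OF S])
  moreover have "finite_cdim (ker_on M S)"
    using U by (simp add: upper_semi_Browder_on_def upper_semi_Fredholm_on_def)
  moreover have "ker_on ?M S \<subseteq> ker_on M S" by (auto simp: ker_on_def)
  ultimately have fin: "finite_cdim (ker_on ?M S)" by (rule finite_cdim_subspace)
  obtain n where n: "ker_on M (S ^^ n) = ker_on M (S ^^ Suc n)"
    using U unfolding upper_semi_Browder_on_def ascent_on_finite_iff by blast
  have "ker_on ?M (S ^^ k) = ker_on M (S ^^ k) \<inter> {x. R x = 0}" for k by (auto simp: ker_on_def)
  then have "ker_on ?M (S ^^ n) = ker_on ?M (S ^^ Suc n)" using n by (simp del: funpow.simps)
  then have "ascent_on ?M S < \<infinity>" unfolding ascent_on_finite_iff by blast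
  with cl fin show ?thesis by (simp add: upper_semi_Browder_on_def upper_semi_Fredholm_on_def)
qed

text \<open>Makes the functionals \<open>f \<circ> T ^^ (m - i)\<close> biorthogonal to the chain.
  Subtracting multiples of later chain vectors from the generator keeps the end of the chain and
  removes the unwanted values of \<open>f\<close>, from index \<open>m - 1\<close>
  downwards.\<close>

lemma normalize_Jordan_chain:
  fixes f :: "'a::complex_banach \<Rightarrow> complex"
  assumes T: "bounded_clinear T" and M: "complex_vector.subspace M" "T ` M \<subseteq> M"
    and f: "bounded_linear f" "\<And>c x. f (c *\<^sub>C x) = c * f x"
    and x0: "x0 \<in> M" "(T ^^ Suc m) x0 = 0" "f ((T ^^ m) x0) = 1"
  obtains x where "x \<in> M" "(T ^^ m) x = (T ^^ m) x0"
    "\<And>j. m < j \<Longrightarrow> (T ^^ j) x = 0" "\<And>j. f ((T ^^ j) x) = (if j = m then 1 else 0)"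
proof -
  interpret f: bounded_linear f by (rule f(1))
  have pw0: "(T ^^ j) y = 0" if "m < j" "(T ^^ Suc m) y = 0" for j y
  proof -
    have "j = (j - Suc m) + Suc m" using that(1) by simp
    then have "(T ^^ j) y = (T ^^ (j - Suc m)) ((T ^^ Suc m) y)" by (metis comp_apply funpow_add)
    then show ?thesis using that(2) bounded_clinear_0[OF bounded_clinear_funpow[OF T]] by simp
  qed
  have "k \<le> m \<Longrightarrow> \<exists>x\<in>M. (T ^^ m) x = (T ^^ m) x0 \<and> (T ^^ Suc m) x = 0 \<and>
      (\<forall>j<m. m \<le> j + k \<longrightarrow> f ((T ^^ j) x) = 0)" for k
  proof (induction k)
    case 0 then show ?case using x0 by (intro bexI[of _ x0]) auto
  next
    case (Suc k)
    then obtain x where x: "x \<in> M" "(T ^^ m) x = (T ^^ m) x0" "(T ^^ Suc m) x = 0"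
      "\<And>j. j < m \<Longrightarrow> m \<le> j + k \<Longrightarrow> f ((T ^^ j) x) = 0" by auto
    \<comment> \<open>At index \<open>m - Suc k\<close> the subtracted vector becomes the end of the
      chain, where \<open>f\<close> is 1, so \<open>c\<close> cancels the value. At the larger
      indices it is already zero, so earlier corrections survive.\<close>
    define c where "c = f ((T ^^ (m - Suc k)) x)"
    define y where "y = x - c *\<^sub>C (T ^^ Suc k) x"
    have Ty: "(T ^^ j) y = (T ^^ j) x - c *\<^sub>C (T ^^ (j + Suc k)) x" for j
      unfolding y_def funpow_add comp_apply
      by (simp only: bounded_clinear_diff[OF bounded_clinear_funpow[OF T]]
          bounded_clinear_scaleC[OF bounded_clinear_funpow[OF T]])
    have "y \<in> M"
      unfolding y_def
      by (intro complex_vector.subspace_diff[OF M(1)] complex_vector.subspace_scale[OF M(1)]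
          funpow_in_invariant[OF _ M(2)] x(1))
    moreover have z: "(T ^^ (j + Suc k)) x = 0" if "m \<le> j + k" for j
      by (rule pw0[OF _ x(3)]) (use that in simp)
    have "(T ^^ m) y = (T ^^ m) x0"
      unfolding Ty z[OF le_add1] by (simp add: x complex_vector.scale_zero_right)
    moreover have "(T ^^ Suc m) y = 0"
      unfolding Ty x(3) by (subst z) (simp_all add: complex_vector.scale_zero_right)
    moreover have "f ((T ^^ j) y) = 0" if j: "j < m" "m \<le> j + Suc k" for j
    proof (cases "m \<le> j + k")
      case True
      then show ?thesis unfolding Ty z[OF True] using x(4) j
        by (simp add: complex_vector.scale_zero_right)
    next
      case False
      then have e: "j + Suc k = m" "j = m - Suc k" using j by auto
      have "f ((T ^^ j) y) = f ((T ^^ j) x) - c * f ((T ^^ m) x)"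
        unfolding Ty e(1) by (simp add: f.diff f(2))
      then show ?thesis using x(2) x0(3) e(2) by (simp add: c_def)
    qed
    ultimately show ?case by blast
  qed
  from this[of m] obtain x where x: "x \<in> M" "(T ^^ m) x = (T ^^ m) x0" "(T ^^ Suc m) x = 0"
      "\<And>j. j < m \<Longrightarrow> f ((T ^^ j) x) = 0" by auto
  show ?thesis
  proof
    show "x \<in> M" "(T ^^ m) x = (T ^^ m) x0" by fact+
    show z: "(T ^^ j) x = 0" if "m < j" for j by (rule pw0[OF that x(3)])
    show "f ((T ^^ j) x) = (if j = m then 1 else 0)" for j
      using x(2,4) x0(3) z[of j] f.zero by (cases "j < m"; cases "j = m") auto
  qed
qed

text \<open>\<open>P'\<close> is \<open>P\<close> plus a projection onto the span of one chain in
  the kernel of \<open>P\<close>. The strict inclusion of kernels is the progress made.\<close>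

lemma split_Jordan_block:
  assumes T: "bounded_clinear T" and P: "bounded_projection P" and TP: "T \<circ> P = P \<circ> T"
    and q: "quasinilpotent_on UNIV (T \<circ> P)" and U: "upper_semi_Browder_on {x. P x = 0} T"
    and ker: "ker_on {x. P x = 0} T \<noteq> {0}"
  obtains P' where "bounded_projection P'" "T \<circ> P' = P' \<circ> T" "quasinilpotent_on UNIV (T \<circ> P')"
    "upper_semi_Browder_on {x. P' x = 0} T"
    "ker_on {x. P' x = 0} T \<subset> ker_on {x. P x = 0} T"
proof -
  note P1 = bounded_projectionD[OF P]
  define M where "M = {x. P x = 0}"
  have TP': "T (P x) = P (T x)" for x using TP by (simp add: fun_eq_iff)
  note TnP = funpow_commute_eq[OF TP]
  note Tn = bounded_clinear_funpow[OF T]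
  note Tn0 = bounded_clinear_0[OF Tn]
  have "(M, range P) \<in> Red T" unfolding M_def by (rule projection_Red[OF T P TP])
  then have M: "closed M" "complex_vector.subspace M" "T ` M \<subseteq> M" by (auto simp: Red_def)
  have U': "upper_semi_Browder_on M T" using U by (simp add: M_def)
  then have UF: "upper_semi_Fredholm_on M T" and
    "\<exists>n. ker_on M (T ^^ n) = ker_on M (T ^^ Suc n)"
    unfolding upper_semi_Browder_on_def ascent_on_finite_iff by auto
  then obtain p where p: "ker_on M (T ^^ p) = ker_on M (T ^^ Suc p)"
    "\<And>n. n < p \<Longrightarrow> ker_on M (T ^^ n) \<noteq> ker_on M (T ^^ Suc n)"
    using exists_least_iff[of "\<lambda>n. ker_on M (T ^^ n) = ker_on M (T ^^ Suc n)"] by blast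
  have "p \<noteq> 0"
  proof
    assume "p = 0"
    then have "ker_on M T = {x \<in> M. x = 0}" using p(1) by (simp add: ker_on_def)
    then show False using ker complex_vector.subspace_0[OF M(2)] by (auto simp: M_def)
  qed
  then obtain m where m: "p = Suc m" using not0_implies_Suc by blast
  have "ker_on M (T ^^ m) \<subseteq> ker_on M (T ^^ Suc m)"
    by (auto simp: ker_on_def bounded_clinear_0[OF T])
  with p(2)[of m] m obtain x0 where x0: "x0 \<in> M" "(T ^^ Suc m) x0 = 0" "(T ^^ m) x0 \<noteq> 0"
    by (auto simp: ker_on_def)
  define e where "e = (T ^^ m) x0"
  have e: "e \<noteq> 0" "e \<in> M" "T e = 0"
    using x0 funpow_in_invariant[OF x0(1) M(3)] by (auto simp: e_def)
  \<comment> \<open>Here the maximal length \<open>p = Suc m\<close> matters: a preimage of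
    \<open>e\<close> would lie in the kernel of \<open>T ^^ Suc p\<close>, hence in that of
    \<open>T ^^ p\<close>, and \<open>e\<close> would be 0.\<close>
  have "e \<notin> (T ^^ Suc m) ` M"
  proof
    assume "e \<in> (T ^^ Suc m) ` M"
    then obtain u where u: "u \<in> M" "e = (T ^^ Suc m) u" by blast
    then have "u \<in> ker_on M (T ^^ Suc p)" using e(3) by (simp add: ker_on_def m)
    then have "u \<in> ker_on M (T ^^ Suc m)" using p(1) m by simp
    then have "(T ^^ Suc m) u = 0" unfolding ker_on_def by blast
    with e(1) u(2) show False by simp
  qed
  moreover have "closed ((T ^^ Suc m) ` M)" by (rule upper_semi_Fredholm_closed_funpow[OF T M UF])
  moreover have "complex_vector.subspace ((T ^^ Suc m) ` M)" by (rule subspace_image_bounded_clinear[OF Tn M(2)])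
  ultimately obtain f :: "'a \<Rightarrow> complex" where f: "bounded_linear f" "\<And>c x. f (c *\<^sub>C x) = c * f x"
    "\<And>x. x \<in> (T ^^ Suc m) ` M \<Longrightarrow> f x = 0" "f e = 1"
    using Hahn_Banach_separate by blast
  interpret f: bounded_linear f by (rule f(1))
  obtain x where x: "x \<in> M" "(T ^^ m) x = e" "\<And>j. m < j \<Longrightarrow> (T ^^ j) x = 0"
    "\<And>j. f ((T ^^ j) x) = (if j = m then 1 else 0)"
    using normalize_Jordan_chain[OF T M(2,3) f(1,2) x0(1,2)] f(4) unfolding e_def by blast
  \<comment> \<open>The functionals \<open>f \<circ> T ^^ (m - i)\<close> are dual to the chain \<open>(T ^^ i) x\<close>; as \<open>f\<close> kills the range
    of \<open>T ^^ Suc m\<close> on \<open>M\<close>, the projection \<open>Q\<close> onto the span of the chain commutes with \<open>T\<close>.\<close>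
  define Q where "Q y = (\<Sum>i<Suc m. f ((T ^^ (m - i)) (y - P y)) *\<^sub>C (T ^^ i) x)" for y
  have Px: "P ((T ^^ i) x) = 0" for i
    using funpow_in_invariant[OF x(1) M(3)] by (simp add: M_def)
  have Qbc: "bounded_clinear Q"
  proof -
    have fl: "bounded_clinear (\<lambda>y. f (A y) *\<^sub>C v)" if A: "bounded_clinear A" for A v
    proof -
      note A' = bounded_clinear_imp_bounded_linear[OF A]
      interpret fA: bounded_linear "\<lambda>y. f (A y)" by (rule bounded_linear_compose[OF f(1) A'])
      obtain K where K: "\<And>y. norm (f (A y)) \<le> norm y * K" using fA.bounded by blast
      have "norm (f (A y) *\<^sub>C v) \<le> norm y * (K * norm v)" for y
        using mult_right_mono[OF K norm_ge_zero, of y v] by (simp add: norm_scaleC mult.assoc)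
      then have "bounded_linear (\<lambda>y. f (A y) *\<^sub>C v)"
      proof (intro bounded_linear_intro)
        show "f (A (y + z)) *\<^sub>C v = f (A y) *\<^sub>C v + f (A z) *\<^sub>C v" for y z
          by (simp only: fA.add scaleC_add_left)
        show "f (A (r *\<^sub>R y)) *\<^sub>C v = r *\<^sub>R f (A y) *\<^sub>C v" for r y
          unfolding fA.scaleR by (simp only: scaleR_scaleC scaleC_scaleC scaleR_conv_of_real)
      qed
      then show ?thesis
        by (simp add: bounded_clinear_def bounded_clinear_scaleC[OF A] f(2) scaleC_scaleC)
    qed
    have sumbc: "bounded_clinear (\<lambda>y. \<Sum>i<n. F i y)" if F: "\<And>i. bounded_clinear (F i)" for n :: nat and F :: "nat \<Rightarrow> 'a \<Rightarrow> 'a"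
    proof (induction n)
      case 0 then show ?case by (simp add: bounded_clinear_def complex_vector.scale_zero_right)
    next
      case (Suc n) then show ?case using bounded_clinear_plus[OF Suc F] by simp
    qed
    show ?thesis
      unfolding Q_def
      by (intro sumbc fl bounded_clinear_comp[OF Tn] bounded_clinear_minus bounded_clinear_ident P1(1))
  qed
  have PQ: "P (Q y) = 0" for y
    unfolding Q_def by (simp add: bounded_clinear_sum[OF P1(1)] bounded_clinear_scaleC[OF P1(1)] Px
        complex_vector.scale_zero_right del: sum.lessThan_Suc)
  have QP: "Q (P y) = 0" for y
    by (simp add: Q_def P1(2) Tn0 f.zero complex_vector.scale_zero_left del: sum.lessThan_Suc)
  have QTx: "Q ((T ^^ k) x) = (T ^^ k) x" if k: "k < Suc m" for k
  proof -
    have "f ((T ^^ (m - i)) ((T ^^ k) x)) = (if i = k then 1 else 0)" if i: "i < Suc m" for i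
    proof -
      have "(T ^^ (m - i)) ((T ^^ k) x) = (T ^^ (m - i + k)) x" by (simp add: funpow_add)
      then show ?thesis using x(4)[of "m - i + k"] i k by auto
    qed
    then have "Q ((T ^^ k) x) = (\<Sum>i<Suc m. if i = k then (T ^^ i) x else 0)"
      unfolding Q_def Px diff_zero
      by (intro sum.cong) (auto simp: scaleC_one complex_vector.scale_zero_left)
    also have "\<dots> = (T ^^ k) x" using k by (subst sum.delta) auto
    finally show ?thesis .
  qed
  have QQ: "Q (Q y) = Q y" for y
  proof -
    have "Q (Q y) = (\<Sum>i<Suc m. f ((T ^^ (m - i)) (y - P y)) *\<^sub>C Q ((T ^^ i) x))"
      by (subst (2) Q_def) (simp add: bounded_clinear_sum[OF Qbc] bounded_clinear_scaleC[OF Qbc] del: sum.lessThan_Suc)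
    also have "\<dots> = Q y" unfolding Q_def[of y] by (intro sum.cong) (auto simp: QTx)
    finally show ?thesis .
  qed
  have TQ: "T (Q y) = Q (T y)" for y
  proof -
    have w: "y - P y \<in> M" by (simp add: M_def bounded_clinear_diff[OF P1(1)] P1(2))
    have Tw: "T y - P (T y) = T (y - P y)" by (simp add: bounded_clinear_diff[OF T] TP')
    have "T (Q y) = (\<Sum>i<Suc m. f ((T ^^ (m - i)) (y - P y)) *\<^sub>C (T ^^ Suc i) x)"
      unfolding Q_def by (simp add: bounded_clinear_sum[OF T] bounded_clinear_scaleC[OF T] del: sum.lessThan_Suc)
    also have "\<dots> = (\<Sum>i<m. f ((T ^^ (m - i)) (y - P y)) *\<^sub>C (T ^^ Suc i) x)"
      unfolding sum.lessThan_Suc using x(3)[of "Suc m"] by (simp add: complex_vector.scale_zero_right del: funpow.simps)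
    also have "\<dots> = (\<Sum>i<m. f ((T ^^ (m - Suc i)) (T (y - P y))) *\<^sub>C (T ^^ Suc i) x)"
    proof (intro sum.cong refl)
      fix i assume "i \<in> {..<m}"
      then have "m - i = Suc (m - Suc i)" by simp
      then have "(T ^^ (m - i)) (y - P y) = (T ^^ (m - Suc i)) (T (y - P y))"
        by (metis comp_apply funpow_Suc_right)
      then show "f ((T ^^ (m - i)) (y - P y)) *\<^sub>C (T ^^ Suc i) x = f ((T ^^ (m - Suc i)) (T (y - P y))) *\<^sub>C (T ^^ Suc i) x"
        by simp
    qed
    \<comment> \<open>The shifted sum lacks the term of index 0 of \<open>Q (T y)\<close>. Its
      coefficient is \<open>f\<close> at a value of \<open>T ^^ Suc m\<close> on \<open>M\<close>,
      so it vanishes.\<close>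
    also have "\<dots> = Q (T y)"
    proof -
      have "(T ^^ (m - 0)) (T (y - P y)) = (T ^^ Suc m) (y - P y)" by (simp add: funpow_swap1)
      then have "f ((T ^^ (m - 0)) (T (y - P y))) = 0" using f(3) w by (metis imageI)
      then show ?thesis
        unfolding Q_def Tw sum.lessThan_Suc_shift by (simp add: complex_vector.scale_zero_left)
    qed
    finally show ?thesis .
  qed
  have Q: "bounded_projection Q" using Qbc QQ by (simp add: bounded_projection_def fun_eq_iff)
  have QM: "Q y \<in> M" for y by (simp add: M_def PQ)
  \<comment> \<open>The argument \<open>y - P y\<close> in \<open>Q\<close> gives
    \<open>Q (P y) = 0\<close>, and the chain lies in the kernel of \<open>P\<close>; so the sum is
    again a projection.\<close>
  define P' where "P' y = P y + Q y" for y
  have P'bc: "bounded_clinear P'" unfolding P'_def by (rule bounded_clinear_plus[OF P1(1) Qbc])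
  have P': "bounded_projection P'"
    using P'bc by (simp add: bounded_projection_def fun_eq_iff P'_def
        bounded_clinear_add[OF P1(1)] bounded_clinear_add[OF Qbc] P1(2) PQ QP QQ)
  have TP'': "T \<circ> P' = P' \<circ> T"
    by (simp add: fun_eq_iff P'_def bounded_clinear_add[OF T] TP' TQ)
  have kerP': "{y. P' y = 0} = M \<inter> {y. Q y = 0}"
  proof -
    have "P (P' y) = P y" for y by (simp add: P'_def bounded_clinear_add[OF P1(1)] P1(2) PQ)
    then have P0: "P y = 0" if "P' y = 0" for y using that bounded_clinear_0[OF P1(1)] by metis
    have "P' y = 0 \<longleftrightarrow> P y = 0 \<and> Q y = 0" for y
      using P0[of y] by (auto simp: P'_def)
    then show ?thesis by (auto simp: M_def)
  qed
  \<comment> \<open>\<open>T ^^ n\<close> kills the block for \<open>n > m\<close>. Quasinilpotence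
    concerns large powers, where \<open>P\<close> and \<open>P'\<close> give the same
    operator.\<close>
  have pw: "((T \<circ> P') ^^ n) y = ((T \<circ> P) ^^ n) y" if n: "m < n" for n y
  proof -
    obtain k where k: "n = Suc k" using n by (cases n) auto
    have Q0: "(T ^^ n) (Q y) = 0"
    proof -
      have z: "(T ^^ n) ((T ^^ i) x) = 0" for i
      proof -
        have "(T ^^ n) ((T ^^ i) x) = (T ^^ (n + i)) x" by (simp add: funpow_add)
        also have "\<dots> = 0" using n by (intro x(3)) simp
        finally show ?thesis .
      qed
      show ?thesis
        unfolding Q_def by (simp add: bounded_clinear_sum[OF Tn] bounded_clinear_scaleC[OF Tn] z
          complex_vector.scale_zero_right del: sum.lessThan_Suc)
    qed
    show ?thesis
      using Q0 unfolding k funpow_comp_projection[OF P' TP''] funpow_comp_projection[OF P TP]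
      by (simp only: P'_def bounded_clinear_add[OF Tn] add_0_right)
  qed
  show ?thesis
  proof
    show "bounded_projection P'" "T \<circ> P' = P' \<circ> T" by fact+
    have bc: "bounded_clinear (T \<circ> P)" "bounded_clinear (T \<circ> P')"
      using bounded_clinear_comp[OF T P1(1)] bounded_clinear_comp[OF T P'bc] by (simp_all add: comp_def)
    show "quasinilpotent_on UNIV (T \<circ> P')"
      unfolding quasinilpotent_on_iff[OF bc(2) UNIV_I]
    proof (intro allI impI)
      fix c :: real assume "c > 0"
      then have "\<forall>\<^sub>F n in sequentially. \<forall>x\<in>UNIV. norm (((T \<circ> P) ^^ n) x) \<le> c ^ n * norm x"
        using q unfolding quasinilpotent_on_iff[OF bc(1) UNIV_I] by blast
      with eventually_gt_at_top[of m]
      show "\<forall>\<^sub>F n in sequentially. \<forall>x\<in>UNIV. norm (((T \<circ> P') ^^ n) x) \<le> c ^ n * norm x"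
        by eventually_elim (simp only: pw)
    qed
    show "upper_semi_Browder_on {x. P' x = 0} T"
      unfolding kerP' by (rule upper_semi_Browder_on_restrict[OF T M(2) Q TQ _ U']) (use QM in blast)
    have "Q e = e" using QTx[of m] x(2) by simp
    then have "e \<in> ker_on M T" "e \<notin> ker_on {x. P' x = 0} T"
      using e by (auto simp: ker_on_def kerP')
    moreover have "ker_on {x. P' x = 0} T \<subseteq> ker_on M T" by (auto simp: ker_on_def kerP')
    ultimately show "ker_on {x. P' x = 0} T \<subset> ker_on {x. P x = 0} T" unfolding M_def by blast
  qed
qed

text \<open>Induction on the size of a finite spanning set of the kernel, with \<open>P\<close>
  varying. Once the kernel is trivial, closed range turns upper semi-Browder into bounded
  below.\<close>

theorem upper_semi_Browder_split_kernel:
  assumes T: "bounded_clinear T" and "bounded_projection P" "T \<circ> P = P \<circ> T"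
    "quasinilpotent_on UNIV (T \<circ> P)" "upper_semi_Browder_on {x. P x = 0} T"
  shows "\<exists>P'. bounded_projection P' \<and> T \<circ> P' = P' \<circ> T \<and> quasinilpotent_on UNIV (T \<circ> P') \<and>
    bounded_below_on {x. P' x = 0} T"
proof -
  have "finite B \<Longrightarrow> complex_vector.span B = ker_on {x. P x = 0} T \<Longrightarrow> bounded_projection P \<Longrightarrow> T \<circ> P = P \<circ> T \<Longrightarrow>
    quasinilpotent_on UNIV (T \<circ> P) \<Longrightarrow> upper_semi_Browder_on {x. P x = 0} T \<Longrightarrow> ?thesis" for B
  proof (induction "card B" arbitrary: B P rule: less_induct)
    case less
    note * = less.prems
    have "({x. P x = 0}, range P) \<in> Red T" by (rule projection_Red[OF T *(3,4)])
    then have M: "closed {x. P x = 0}" "complex_vector.subspace {x. P x = 0}" by (auto simp: Red_def)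
    show ?case
    proof (cases "ker_on {x. P x = 0} T = {0}")
      case True
      then have "bounded_below_on {x. P x = 0} T"
        using *(6) bounded_below_on_iff[OF bounded_clinear_imp_bounded_linear[OF T] M(1) complex_subspace_imp_subspace[OF M(2)]]
        by (simp add: upper_semi_Browder_on_def upper_semi_Fredholm_on_def)
      then show ?thesis using * by blast
    next
      case False
      obtain P' where P': "bounded_projection P'" "T \<circ> P' = P' \<circ> T" "quasinilpotent_on UNIV (T \<circ> P')"
        "upper_semi_Browder_on {x. P' x = 0} T" "ker_on {x. P' x = 0} T \<subset> ker_on {x. P x = 0} T"
        using split_Jordan_block[OF T *(3-6) False] by blast
      have "({x. P' x = 0}, range P') \<in> Red T" by (rule projection_Red[OF T P'(1,2)])
      then have "complex_vector.subspace {x. P' x = 0}" by (auto simp: Red_def)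
      then have sub: "complex_vector.subspace (ker_on {x. P' x = 0} T)" by (rule subspace_ker_on[OF T])
      have "ker_on {x. P' x = 0} T \<subseteq> complex_vector.span B" using P'(5) *(2) by blast
      then obtain A where A: "finite A" "complex_vector.span A = ker_on {x. P' x = 0} T"
        "ker_on {x. P' x = 0} T \<noteq> complex_vector.span B \<Longrightarrow> card A < card B"
        using complex_subspace_basis[OF sub *(1)] by metis
      show ?thesis using A P' *(2) by (intro less.hyps[of A P']) auto
    qed
  qed
  moreover obtain B where "finite B" "complex_vector.span B = ker_on {x. P x = 0} T"
    using assms(5) by (auto simp: upper_semi_Browder_on_def upper_semi_Fredholm_on_def finite_cdim_def)
  ultimately show ?thesis using assms by blast
qed

section \<open>The equivalences\<close>

lemma RedD:
  assumes "(M, N) \<in> Red T"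
  shows "closed M" "complex_vector.subspace M" "T ` M \<subseteq> M"
    "closed N" "complex_vector.subspace N" "T ` N \<subseteq> N" "M \<inter> N = {0}"
  using assms by (auto simp: Red_def)

lemma quasinilpotent_part_unique:
  assumes T: "bounded_clinear T" and red: "(M, N) \<in> Red T"
    and bb: "bounded_below_on M T" and q: "quasinilpotent_on N T"
  shows "N = quasinilpotent_part T"
proof
  note M = RedD[OF red]
  have N0: "0 \<in> N" by (rule complex_vector.subspace_0[OF M(5)])
  note q' = q[unfolded quasinilpotent_on_iff[OF T N0]]
  show "N \<subseteq> quasinilpotent_part T"
  proof (intro subsetI, unfold quasinilpotent_part_iff, intro allI impI)
    fix x and e :: real assume x: "x \<in> N" and e: "e > 0"
    then have "\<forall>\<^sub>F n in sequentially. \<forall>x\<in>N. norm ((T ^^ n) x) \<le> (e / 2) ^ n * norm x"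
      using q' by simp
    with eventually_le_power[OF e, of "norm x"]
    show "\<forall>\<^sub>F n in sequentially. norm ((T ^^ n) x) \<le> e ^ n"
      by eventually_elim (use x in \<open>auto simp: mult.commute intro: order_trans\<close>)
  qed
  obtain P where P: "bounded_projection P" "T \<circ> P = P \<circ> T" "M = {x. P x = 0}" "N = range P"
    using Red_projection[OF T red] by blast
  note P1 = bounded_projectionD[OF P(1)]
  obtain L where L: "L \<ge> 0" "\<And>x. norm (P x) \<le> norm x * L"
    using bounded_linear.nonneg_bounded[OF bounded_clinear_imp_bounded_linear[OF P1(1)]] by blast
  obtain c where c: "c > 0" "\<And>x. x \<in> M \<Longrightarrow> c * norm x \<le> norm (T x)"
    using bb by (auto simp: bounded_below_on_def)
  show "quasinilpotent_part T \<subseteq> N"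
  proof
    fix x assume x: "x \<in> quasinilpotent_part T"
    define m where "m = x - P x"
    have m: "m \<in> M" by (simp add: m_def P(3) bounded_clinear_diff[OF P1(1)] P1(2))
    have low: "c ^ n * norm m \<le> norm ((T ^^ n) m)" for n
    proof (induction n)
      case (Suc n)
      have "c ^ Suc n * norm m \<le> c * norm ((T ^^ n) m)"
        using mult_left_mono[OF Suc, of c] c(1) by (simp add: mult.assoc)
      also have "\<dots> \<le> norm (T ((T ^^ n) m))" by (rule c(2)[OF funpow_in_invariant[OF m M(3)]])
      finally show ?case by simp
    qed simp
    have up: "norm ((T ^^ n) m) \<le> (1 + L) * norm ((T ^^ n) x)" for n
    proof -
      have eq: "(T ^^ n) m = (T ^^ n) x - P ((T ^^ n) x)"
        by (simp add: m_def bounded_clinear_diff[OF bounded_clinear_funpow[OF T]] funpow_commute_eq[OF P(2)])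
      show ?thesis
        unfolding eq using norm_triangle_ineq4[of "(T ^^ n) x" "P ((T ^^ n) x)"] L(2)[of "(T ^^ n) x"]
        by (simp add: distrib_right mult.commute)
    qed
    \<comment> \<open>Decay at rate \<open>c / 4\<close> is played against growth at rate
      \<open>c\<close>: one halving absorbs \<open>1 + L\<close>, the other leaves
      \<open>(1 / 2) ^ n\<close>, which forces \<open>norm m = 0\<close>.\<close>
    have c2: "c / 2 > 0" "c / 2 / 2 > 0" using c by auto
    have "\<forall>\<^sub>F n in sequentially. norm ((T ^^ n) x) \<le> (c / 2 / 2) ^ n"
      using x c2(2) unfolding quasinilpotent_part_iff by blast
    with eventually_le_power[OF c2(1), of "1 + L"]
    have "\<forall>\<^sub>F n in sequentially. norm m \<le> (1 / 2) ^ n"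
    proof eventually_elim
      case (elim n)
      have "c ^ n * norm m \<le> (1 + L) * norm ((T ^^ n) x)" using low up order_trans by blast
      also have "\<dots> \<le> (1 + L) * (c / 2 / 2) ^ n" using elim L by (intro mult_left_mono) auto
      also have "\<dots> \<le> (c / 2) ^ n" using elim by simp
      also have "\<dots> = c ^ n * (1 / 2) ^ n" by (simp add: power_divide)
      finally show ?case using c(1) by (metis mult_le_cancel_left_pos zero_less_power)
    qed
    moreover have "(\<lambda>n. (1 / 2 :: real) ^ n) \<longlonglongrightarrow> 0" by (rule LIMSEQ_power_zero) simp
    ultimately have "norm m \<le> 0" by (intro tendsto_lowerbound) auto
    then have "x = P x" by (simp add: m_def)
    then show "x \<in> N" unfolding P(4) by (rule range_eqI)
  qed
qed

lemma quasinilpotent_on_quasinilpotent_part: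
  assumes T: "bounded_clinear T" and H: "closed (quasinilpotent_part T)" "complex_vector.subspace (quasinilpotent_part T)"
  shows "quasinilpotent_on (quasinilpotent_part T) T"
  unfolding quasinilpotent_on_iff[OF T complex_vector.subspace_0[OF H(2)]]
proof (intro allI impI)
  let ?H = "quasinilpotent_part T"
  fix e :: real assume e: "e > 0"
  \<comment> \<open>Dividing by the rate \<open>e / 2\<close> makes the powers pointwise bounded on
    the quasinilpotent part; the uniform constant is then absorbed by passing to the rate
    \<open>e\<close>.\<close>
  define F where "F n x = (1 / (e / 2) ^ n) *\<^sub>R (T ^^ n) x" for n x
  have F: "bounded_linear (F n)" for n
    unfolding F_def
    by (rule bounded_linear_compose[OF bounded_linear_scaleR_right
        bounded_clinear_imp_bounded_linear[OF bounded_clinear_funpow[OF T]]])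
  have nF: "norm (F n x) = norm ((T ^^ n) x) / (e / 2) ^ n" for n x
    using e by (simp add: F_def)
  have bd: "\<exists>C. \<forall>n. norm (F n x) \<le> C" if "x \<in> ?H" for x
  proof -
    have "e / 2 > 0" using e by simp
    then have "\<forall>\<^sub>F n in sequentially. norm ((T ^^ n) x) \<le> (e / 2) ^ n"
      using that unfolding quasinilpotent_part_iff by blast
    then obtain N where N: "\<And>n. n \<ge> N \<Longrightarrow> norm ((T ^^ n) x) \<le> (e / 2) ^ n"
      unfolding eventually_sequentially by blast
    \<comment> \<open>The term 1 covers the indices from \<open>N\<close> on, the sum the finitely
      many earlier ones.\<close>
    have "norm (F n x) \<le> 1 + (\<Sum>k<N. norm (F k x))" for n
    proof (cases "n < N")
      case True
      then have "norm (F n x) \<le> (\<Sum>k<N. norm (F k x))" by (intro member_le_sum) auto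
      then show ?thesis by simp
    next
      case False
      then have "norm (F n x) \<le> 1" using N[of n] e by (simp add: nF)
      also have "1 \<le> 1 + (\<Sum>k<N. norm (F k x))" by (simp add: sum_nonneg)
      finally show ?thesis .
    qed
    then show ?thesis by blast
  qed
  obtain C where C: "C > 0" "\<And>n x. x \<in> ?H \<Longrightarrow> norm (F n x) \<le> C * norm x"
    using Banach_Steinhaus_on[OF H(1) complex_subspace_imp_subspace[OF H(2)] F bd] by blast
  show "\<forall>\<^sub>F n in sequentially. \<forall>x\<in>?H. norm ((T ^^ n) x) \<le> e ^ n * norm x"
    using eventually_le_power[OF e, of C]
  proof eventually_elim
    case (elim n)
    show ?case
    proof
      fix x assume "x \<in> ?H"
      then have "norm ((T ^^ n) x) \<le> (C * (e / 2) ^ n) * norm x"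
        using C(2)[of x n] e unfolding nF by (simp add: pos_divide_le_eq mult_ac)
      also have "\<dots> \<le> e ^ n * norm x" using elim by (intro mult_right_mono) auto
      finally show "norm ((T ^^ n) x) \<le> e ^ n * norm x" .
    qed
  qed
qed

lemma ker_subset_quasinilpotent_part:
  assumes "bounded_clinear T" "T x = 0"
  shows "x \<in> quasinilpotent_part T"
  unfolding quasinilpotent_part_iff
proof (intro allI impI)
  fix e :: real assume "e > 0"
  have "(T ^^ n) x = 0" if n: "n > 0" for n
  proof -
    obtain k where "n = Suc k" using n by (cases n) auto
    then have "(T ^^ n) x = (T ^^ k) (T x)" by (simp add: funpow_swap1)
    then show ?thesis using assms(2) bounded_clinear_0[OF bounded_clinear_funpow[OF assms(1)]] by simp
  qed
  with \<open>e > 0\<close> show "\<forall>\<^sub>F n in sequentially. norm ((T ^^ n) x) \<le> e ^ n"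
    by (intro eventually_mono[OF eventually_gt_at_top[of 0]]) simp
qed

text \<open>The kernel of \<open>T\<close> is contained in the quasinilpotent part and so meets
  \<open>M\<close> trivially; closedness of the image of \<open>M\<close> then yields boundedness
  below.\<close>

lemma closed_quasinilpotent_part_imp_decomposition:
  assumes T: "bounded_clinear T" and red: "(M, quasinilpotent_part T) \<in> Red T" and cl: "closed (T ` M)"
  shows "bounded_below_on M T" "quasinilpotent_on (quasinilpotent_part T) T"
proof -
  note M = RedD[OF red]
  have "ker_on M T \<subseteq> M \<inter> quasinilpotent_part T"
    using ker_subset_quasinilpotent_part[OF T] by (auto simp: ker_on_def)
  moreover have "0 \<in> ker_on M T"
    using complex_vector.subspace_0[OF M(2)] by (simp add: ker_on_def bounded_clinear_0[OF T])
  ultimately have "ker_on M T = {0}" using M(7) by blast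
  with cl show "bounded_below_on M T"
    by (simp add: bounded_below_on_iff[OF bounded_clinear_imp_bounded_linear[OF T] M(1) complex_subspace_imp_subspace[OF M(2)]])
  show "quasinilpotent_on (quasinilpotent_part T) T"
    by (rule quasinilpotent_on_quasinilpotent_part[OF T M(4,5)])
qed

section \<open>Spectral conditions\<close>

lemma decomposition_imp_sigma_ap:
  assumes T: "bounded_clinear T" and red: "(M, N) \<in> Red T"
    and bb: "bounded_below_on M T" and q: "quasinilpotent_on N T"
  shows "\<not> 0 islimpt sigma_ap T"
proof
  assume lim: "0 islimpt sigma_ap T"
  obtain P where P: "bounded_projection P" "T \<circ> P = P \<circ> T" "M = {x. P x = 0}" "N = range P"
    using Red_projection[OF T red] by blast
  note P1 = bounded_projectionD[OF P(1)]
  obtain d where d: "d > 0" "\<And>z. cmod z < d \<Longrightarrow> bounded_below_on M (\<lambda>x. T x - z *\<^sub>C x)"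
    using bounded_below_shift[OF bb] by blast
  obtain z where z: "z \<in> sigma_ap T" "z \<noteq> 0" "cmod z < d"
    using lim d(1) unfolding islimpt_approachable by (auto simp: dist_norm)
  have "bounded_below_on UNIV (\<lambda>x. T x - z *\<^sub>C x)"
  proof (rule bounded_below_direct_sum[OF bounded_clinear_shift[OF T] P(1)])
    show "T (P x) - z *\<^sub>C P x = P (T x - z *\<^sub>C x)" for x
      using P(2) by (simp add: fun_eq_iff bounded_clinear_diff[OF P1(1)] bounded_clinear_scaleC[OF P1(1)])
    show "bounded_below_on {x. P x = 0} (\<lambda>x. T x - z *\<^sub>C x)" using d(2)[OF z(3)] unfolding P(3) .
    show "bounded_below_on (range P) (\<lambda>x. T x - z *\<^sub>C x)"
      unfolding P(4)[symmetric]
      by (rule quasinilpotent_shift_bounded_below[OF T complex_vector.subspace_0[OF RedD(5)[OF red]] q z(2)])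
  qed
  with z(1) show False by (simp add: sigma_ap_def)
qed

lemma sigma_Bplus_subset_sigma_ap:
  assumes "bounded_clinear T" shows "sigma_Bplus T \<subseteq> sigma_ap T"
  using bounded_below_on_imp_upper_semi_Browder_on[OF bounded_clinear_shift[OF assms] closed_UNIV complex_vector.subspace_UNIV]
  by (auto simp: sigma_Bplus_def sigma_ap_def)

lemma generalized_Kato_imp_decomposition:
  assumes T: "bounded_clinear T" and K: "generalized_Kato_decomposition T" and int: "0 \<notin> interior (sigma_Bplus T)"
  shows "\<exists>M N. (M, N) \<in> Red T \<and> bounded_below_on M T \<and> quasinilpotent_on N T"
proof -
  obtain M N where MN: "(M, N) \<in> Red T" "Kato_on M T" "quasinilpotent_on N T"
    using K by (auto simp: generalized_Kato_decomposition_def)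
  obtain d where d: "d > 0"
    "\<And>z. cmod z < d \<Longrightarrow> ascent_on UNIV (\<lambda>x. T x - z *\<^sub>C x) < \<infinity> \<Longrightarrow> bounded_below_on M T"
    using Kato_on_shift_finite_ascent[OF T RedD(1-3)[OF MN(1)] MN(2)] by blast
  \<comment> \<open>One point of the disc outside \<open>sigma_Bplus T\<close> suffices, because the
    conclusion drawn from it concerns \<open>T\<close> itself; the point may be 0.\<close>
  have "\<not> ball 0 d \<subseteq> sigma_Bplus T" using int d(1) by (meson mem_interior)
  then obtain z where "z \<in> ball 0 d" "z \<notin> sigma_Bplus T" by blast
  then have "bounded_below_on M T"
    by (intro d(2)[of z]) (simp_all add: sigma_Bplus_def upper_semi_Browder_on_def)
  with MN show ?thesis by blast
qed

section \<open>Conditions on commuting projections\<close>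

lemma decomposition_imp_projection:
  assumes T: "bounded_clinear T" and red: "(M, N) \<in> Red T"
    and bb: "bounded_below_on M T" and q: "quasinilpotent_on N T"
  shows "\<exists>P. bounded_projection P \<and> T \<circ> P = P \<circ> T \<and>
    bounded_below_on UNIV (\<lambda>x. T x + P x) \<and> quasinilpotent_on UNIV (T \<circ> P)"
proof -
  obtain P where P: "bounded_projection P" "T \<circ> P = P \<circ> T" "M = {x. P x = 0}" "N = range P"
    using Red_projection[OF T red] by blast
  note P1 = bounded_projectionD[OF P(1)]
  have "bounded_below_on UNIV (\<lambda>x. T x + P x)"
  proof (rule bounded_below_direct_sum[OF bounded_clinear_plus[OF T P1(1)] P(1)])
    show "T (P x) + P (P x) = P (T x + P x)" for x
      using P(2) by (simp add: fun_eq_iff bounded_clinear_add[OF P1(1)])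
    have "bounded_below_on M (\<lambda>x. T x + P x) \<longleftrightarrow> bounded_below_on M T"
      by (rule bounded_below_on_cong) (simp add: P(3))
    then show "bounded_below_on {x. P x = 0} (\<lambda>x. T x + P x)" using bb unfolding P(3) by blast
    \<comment> \<open>On \<open>N\<close> the projection is the identity, so \<open>T + P\<close> is
      the shift of a quasinilpotent operator by -1.\<close>
    have "bounded_below_on N (\<lambda>x. T x + P x) \<longleftrightarrow> bounded_below_on N (\<lambda>x. T x - (- 1) *\<^sub>C x)"
      by (rule bounded_below_on_cong)
         (auto simp: P(4) P1(2) complex_vector.scale_minus_left scaleC_one)
    moreover have "bounded_below_on N (\<lambda>x. T x - (- 1) *\<^sub>C x)"
      by (rule quasinilpotent_shift_bounded_below[OF T complex_vector.subspace_0[OF RedD(5)[OF red]] q]) simp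
    ultimately show "bounded_below_on (range P) (\<lambda>x. T x + P x)" unfolding P(4) by blast
  qed
  moreover have "quasinilpotent_on UNIV (T \<circ> P)"
    using q quasinilpotent_on_range_iff[OF T P(1,2)] unfolding P(4) by blast
  ultimately show ?thesis using P by blast
qed

lemma projection_imp_decomposition:
  assumes T: "bounded_clinear T" and P: "bounded_projection P" "T \<circ> P = P \<circ> T"
    and bb: "bounded_below_on {x. P x = 0} T" and q: "quasinilpotent_on UNIV (T \<circ> P)"
  shows "\<exists>M N. (M, N) \<in> Red T \<and> bounded_below_on M T \<and> quasinilpotent_on N T"
  using projection_Red[OF T P] bb q quasinilpotent_on_range_iff[OF T P] by blast

text \<open>\<open>P\<close> commutes with \<open>T + P\<close>, so the latter can be restricted to
  the kernel of \<open>P\<close>, where it coincides with \<open>T\<close>.\<close>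

lemma upper_semi_Browder_projection_imp_decomposition:
  assumes T: "bounded_clinear T" and P: "bounded_projection P" "T \<circ> P = P \<circ> T"
    and U: "upper_semi_Browder_on UNIV (\<lambda>x. T x + P x)" and q: "quasinilpotent_on UNIV (T \<circ> P)"
  shows "\<exists>M N. (M, N) \<in> Red T \<and> upper_semi_Browder_on M T \<and> quasinilpotent_on N T"
proof -
  note P1 = bounded_projectionD[OF P(1)]
  note red = projection_Red[OF T P]
  have "upper_semi_Browder_on (UNIV \<inter> {x. P x = 0}) (\<lambda>x. T x + P x)"
    using P(2)
    by (intro upper_semi_Browder_on_restrict[OF bounded_clinear_plus[OF T P1(1)] complex_vector.subspace_UNIV P(1) _ _ U])
       (auto simp: fun_eq_iff bounded_clinear_add[OF P1(1)])
  moreover have "upper_semi_Browder_on {x. P x = 0} (\<lambda>x. T x + P x) \<longleftrightarrow> upper_semi_Browder_on {x. P x = 0} T"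
    by (rule upper_semi_Browder_on_cong[OF _ RedD(3)[OF red]]) simp
  ultimately have "upper_semi_Browder_on {x. P x = 0} T" by simp
  with red q quasinilpotent_on_range_iff[OF T P] show ?thesis by blast
qed

lemma upper_semi_Browder_decomposition_imp_decomposition:
  assumes T: "bounded_clinear T" and red: "(M, N) \<in> Red T"
    and U: "upper_semi_Browder_on M T" and q: "quasinilpotent_on N T"
  shows "\<exists>M N. (M, N) \<in> Red T \<and> bounded_below_on M T \<and> quasinilpotent_on N T"
proof -
  obtain P where P: "bounded_projection P" "T \<circ> P = P \<circ> T" "M = {x. P x = 0}" "N = range P"
    using Red_projection[OF T red] by blast
  have "quasinilpotent_on UNIV (T \<circ> P)"
    using q quasinilpotent_on_range_iff[OF T P(1,2)] unfolding P(4) by blast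
  then obtain P' where "bounded_projection P'" "T \<circ> P' = P' \<circ> T" "quasinilpotent_on UNIV (T \<circ> P')"
    "bounded_below_on {x. P' x = 0} T"
    using upper_semi_Browder_split_kernel[OF T P(1,2)] U unfolding P(3) by blast
  then show ?thesis using projection_imp_decomposition[OF T] by blast
qed

theorem theorem3p4:
  fixes T :: "'a::complex_banach \<Rightarrow> 'a"
  assumes infinite_dim: "\<not> finite_cdim (UNIV :: 'a set)"
    and T: "bounded_clinear T"
  shows "let
      i = (closed (quasinilpotent_part T) \<and>
           (\<exists>M. closed M \<and> complex_vector.subspace M \<and>
                (M, quasinilpotent_part T) \<in> Red T \<and> closed (T ` M)));
      ii_decomp = (\<lambda>M N. (M, N) \<in> Red T \<and> bounded_below_on M T \<and> quasinilpotent_on N T);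
      ii = (\<exists>M N. ii_decomp M N);
      iii = (generalized_Kato_decomposition T \<and> \<not> 0 islimpt sigma_ap T);
      iv = (generalized_Kato_decomposition T \<and> 0 \<notin> interior (sigma_ap T));
      v = (\<exists>P. bounded_projection P \<and> T \<circ> P = P \<circ> T \<and>
               bounded_below_on UNIV (\<lambda>x. T x + P x) \<and> quasinilpotent_on UNIV (T \<circ> P));
      vi = (\<exists>M N. (M, N) \<in> Red T \<and> upper_semi_Browder_on M T \<and> quasinilpotent_on N T);
      vii = (generalized_Kato_decomposition T \<and> \<not> 0 islimpt sigma_Bplus T);
      viii = (generalized_Kato_decomposition T \<and> 0 \<notin> interior (sigma_Bplus T));
      ix = (\<exists>P. bounded_projection P \<and> T \<circ> P = P \<circ> T \<and>
                upper_semi_Browder_on UNIV (\<lambda>x. T x + P x) \<and> quasinilpotent_on UNIV (T \<circ> P))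
    in
      (i \<longleftrightarrow> ii) \<and> (i \<longleftrightarrow> iii) \<and> (i \<longleftrightarrow> iv) \<and> (i \<longleftrightarrow> v) \<and>
      (i \<longleftrightarrow> vi) \<and> (i \<longleftrightarrow> vii) \<and> (i \<longleftrightarrow> viii) \<and> (i \<longleftrightarrow> ix) \<and>
      (i \<or> ii \<or> iii \<or> iv \<or> v \<or> vi \<or> vii \<or> viii \<or> ix \<longrightarrow>
         (\<exists>!N. \<exists>M. ii_decomp M N) \<and> (\<forall>M N. ii_decomp M N \<longrightarrow> N = quasinilpotent_part T))"
proof -
  define H where "H = quasinilpotent_part T"
  define D where "D M N \<longleftrightarrow> (M, N) \<in> Red T \<and> bounded_below_on M T \<and> quasinilpotent_on N T" for M N
  define i where "i \<longleftrightarrow> closed H \<and> (\<exists>M. closed M \<and> complex_vector.subspace M \<and> (M, H) \<in> Red T \<and> closed (T ` M))"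
  define ii where "ii \<longleftrightarrow> (\<exists>M N. D M N)"
  define iii where "iii \<longleftrightarrow> generalized_Kato_decomposition T \<and> \<not> 0 islimpt sigma_ap T"
  define iv where "iv \<longleftrightarrow> generalized_Kato_decomposition T \<and> 0 \<notin> interior (sigma_ap T)"
  define v where "v \<longleftrightarrow> (\<exists>P. bounded_projection P \<and> T \<circ> P = P \<circ> T \<and>
    bounded_below_on UNIV (\<lambda>x. T x + P x) \<and> quasinilpotent_on UNIV (T \<circ> P))"
  define vi where "vi \<longleftrightarrow> (\<exists>M N. (M, N) \<in> Red T \<and> upper_semi_Browder_on M T \<and> quasinilpotent_on N T)"
  define vii where "vii \<longleftrightarrow> generalized_Kato_decomposition T \<and> \<not> 0 islimpt sigma_Bplus T"
  define viii where "viii \<longleftrightarrow> generalized_Kato_decomposition T \<and> 0 \<notin> interior (sigma_Bplus T)"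
  define ix where "ix \<longleftrightarrow> (\<exists>P. bounded_projection P \<and> T \<circ> P = P \<circ> T \<and>
    upper_semi_Browder_on UNIV (\<lambda>x. T x + P x) \<and> quasinilpotent_on UNIV (T \<circ> P))"
  have DH: "N = H" if "D M N" for M N
    using quasinilpotent_part_unique[OF T] that unfolding D_def H_def by blast
  have i_ii: "i \<Longrightarrow> ii"
    using closed_quasinilpotent_part_imp_decomposition[OF T] unfolding i_def ii_def D_def H_def by blast
  have ii_i: i if ii
  proof -
    from that obtain M N where D: "D M N" by (auto simp: ii_def)
    then have red: "(M, H) \<in> Red T" using DH by (auto simp: D_def)
    note M = RedD[OF red]
    have "closed (T ` M)"
      using D bounded_below_on_imp_closed_image[OF bounded_clinear_imp_bounded_linear[OF T] M(1) complex_subspace_imp_subspace[OF M(2)]]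
      by (simp add: D_def)
    with red M show i by (auto simp: i_def)
  qed
  have ii_iii: iii if ii
  proof -
    from that obtain M N where D: "(M, N) \<in> Red T" "bounded_below_on M T" "quasinilpotent_on N T"
      by (auto simp: ii_def D_def)
    then have "generalized_Kato_decomposition T"
      using bounded_below_on_imp_Kato_on[OF T RedD(1,2)[OF D(1)]] by (auto simp: generalized_Kato_decomposition_def)
    with decomposition_imp_sigma_ap[OF T D] show iii by (simp add: iii_def)
  qed
  have iii_iv: "iii \<Longrightarrow> iv" using interior_limit_point by (auto simp: iii_def iv_def)
  have iii_vii: "iii \<Longrightarrow> vii"
    using islimpt_subset[OF _ sigma_Bplus_subset_sigma_ap[OF T]] by (auto simp: iii_def vii_def)
  have vii_viii: "vii \<Longrightarrow> viii" using interior_limit_point by (auto simp: vii_def viii_def)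
  have iv_viii: "iv \<Longrightarrow> viii"
    using interior_mono[OF sigma_Bplus_subset_sigma_ap[OF T]] by (auto simp: iv_def viii_def)
  have viii_ii: "viii \<Longrightarrow> ii"
    using generalized_Kato_imp_decomposition[OF T] by (auto simp: viii_def ii_def D_def)
  have ii_v: "ii \<Longrightarrow> v"
    using decomposition_imp_projection[OF T] unfolding ii_def D_def v_def by blast
  have v_ix: "v \<Longrightarrow> ix"
    using bounded_below_on_imp_upper_semi_Browder_on[OF bounded_clinear_plus[OF T bounded_projectionD(1)] closed_UNIV complex_vector.subspace_UNIV]
    unfolding v_def ix_def by blast
  have ix_vi: "ix \<Longrightarrow> vi"
    using upper_semi_Browder_projection_imp_decomposition[OF T] unfolding ix_def vi_def by blast
  have vi_ii: "vi \<Longrightarrow> ii"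
    using upper_semi_Browder_decomposition_imp_decomposition[OF T] unfolding vi_def ii_def D_def by blast
  \<comment> \<open>Two cycles meet in \<open>ii\<close>: one through \<open>iii\<close>, then
    \<open>iv\<close> or \<open>vii\<close>, then \<open>viii\<close>; the other through
    \<open>v\<close>, \<open>ix\<close> and \<open>vi\<close>.\<close>
  have eq: "i = ii" "i = iii" "i = iv" "i = v" "i = vi" "i = vii" "i = viii" "i = ix"
    using i_ii ii_i ii_iii iii_iv iii_vii vii_viii iv_viii viii_ii ii_v v_ix ix_vi vi_ii by blast+
  have "(i \<longleftrightarrow> ii) \<and> (i \<longleftrightarrow> iii) \<and> (i \<longleftrightarrow> iv) \<and> (i \<longleftrightarrow> v) \<and>
      (i \<longleftrightarrow> vi) \<and> (i \<longleftrightarrow> vii) \<and> (i \<longleftrightarrow> viii) \<and> (i \<longleftrightarrow> ix) \<and>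
      (i \<or> ii \<or> iii \<or> iv \<or> v \<or> vi \<or> vii \<or> viii \<or> ix \<longrightarrow>
         (\<exists>!N. \<exists>M. D M N) \<and> (\<forall>M N. D M N \<longrightarrow> N = H))"
  proof (intro conjI impI eq)
    assume "i \<or> ii \<or> iii \<or> iv \<or> v \<or> vi \<or> vii \<or> viii \<or> ix"
    then have ii using eq by blast
    then obtain M N where "D M N" by (auto simp: ii_def)
    then show "\<exists>!N. \<exists>M. D M N" using DH by blast
    show "\<forall>M N. D M N \<longrightarrow> N = H" using DH by blast
  qed
  then show ?thesis
    unfolding Let_def i_def ii_def iii_def iv_def v_def vi_def vii_def viii_def ix_def D_def H_def .
qed

end
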